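(* Assume that $F$ is non-decreasing on $\mathbb R$, and that $H$ is differentiable of bounded variation on $\mathbb R$ such that $\sup_{y\in\mathbb R}|H'(y)|<\infty$. Suppose that $F(-\infty)=H(-\infty)$ and $F(\infty)=H(\infty)$. Let $$f(t)=\int_{\mathbb R}e^{-ity}\,dF(y),\qquad h(t)=\int_{\mathbb R}e^{-ity}\,dH(y),\qquad t\in\mathbb R.$$ Suppose that $r>0$ and that $f$ and $h$ have analytic extensions on $D_r=\{z\in\mathbb C:|z|<r\}$. Then, for any $T\ge r$, $$\begin{aligned}\sup_{y\in\mathbb R}|F(y)-H(y)|\le{}&\frac1\pi\sup_{y\le0}\Big|\int_{\mathcal C_r^-}\frac{f(z)-h(z)}{z}e^{izy}e^{-ib\frac zT}dz\Big|+\frac1\pi\sup_{y>0}\Big|\int_{\mathcal C_r^+}\frac{f(z)-h(z)}{z}e^{izy}e^{-ib\frac zT}dz\Big|\\&+\frac1\pi\sup_{y\le0}\Big|\int_{\mathcal C_r^-}\frac{f(z)-h(z)}{z}e^{izy}e^{ib\frac zT}dz\Big|+\frac1\pi\sup_{y>0}\Big|\int_{\mathcal C_r^+}\frac{f(z)-h(z)}{z}e^{izy}e^{ib\frac zT}dz\Big|\\&+\frac1\pi\int_{r\le|t|\le T}\Big|\frac{f(t)-h(t)}{t}\Big|dt+\frac{2}{\pi T}\int_{-T}^T|f(t)-h(t)|\,dt+\frac{3b}{T}\sup_{y\in\mathbb R}|H'(y)|,\end{aligned}$$ where $b>0$ is a fixed constant satisfying $\int_{-b}^b\rho(y)\,dy=3/4$,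 and $\mathcal C_r^-$ and $\mathcal C_r^+$ are the semicircles $\mathcal C_r^-=\{z\in\mathbb C:|z|=r,\ \Im z<0\}$, $\mathcal C_r^+=\{z\in\mathbb C:|z|=r,\ \Im z>0\}$.
   Context: $F(\pm\infty)$, $H(\pm\infty)$ denote limits at $\pm\infty$. $\rho$ is the probability density on $\mathbb R$ given by $\rho(0)=\frac1{2\pi}$ and $\rho(y)=\frac1{2\pi}\Big(\frac{\sin(y/2)}{y/2}\Big)^2$ for $y\ne0$. The extensions of $f$ and $h$ are denoted by the same letters. The semicircles $\mathcal C_r^\pm$ are traversed from $-r$ to $r$.
   Formalization: Since f and h are extended only to the open disc |z|<r (with F Laplace and r=1, f has poles on |z|=r), the integrals over the semicircles of radius r are read as limits, as s increases to r, of integrals over semicircles of radius s; for extensions continuous up to |z|=r these agree. *)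

theory Defs
  imports "HOL-Complex_Analysis.Complex_Analysis"
begin

definition variation_sums :: "(real \<Rightarrow> real) \<Rightarrow> real set \<Rightarrow> real set" where
  "variation_sums G A =
     {(\<Sum>i<n. \<bar>G (p (Suc i)) - G (p i)\<bar>) | (p :: nat \<Rightarrow> real) n. mono p \<and> p ` {..n} \<subseteq> A}"

definition bounded_variation :: "(real \<Rightarrow> real) \<Rightarrow> bool" where
  "bounded_variation G \<longleftrightarrow> bdd_above (variation_sums G UNIV)"

definition variation_upto :: "(real \<Rightarrow> real) \<Rightarrow> real \<Rightarrow> real" where
  "variation_upto G x = Sup (variation_sums G {..x})"

text \<open>
  The constant \<^const>\<open>interval_measure\<close> expects a right-continuous function, so
  nondecreasing functions are first replaced by their right limits; this does not change
  the Stieltjes measure.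
\<close>

definition right_limit :: "(real \<Rightarrow> real) \<Rightarrow> real \<Rightarrow> real" where
  "right_limit G x = Lim (at_right x) G"

text \<open>
  Lebesgue--Stieltjes integral over the real line with respect to a function \<open>G\<close> of bounded
  variation, through the Jordan decomposition \<open>G = V - (V - G)\<close> into nondecreasing functions,
  where \<open>V x\<close> is the total variation of \<open>G\<close> on \<open>(-\<infinity>, x]\<close>. If \<open>G\<close> is itself nondecreasing,
  then \<open>V - G\<close> is constant and the second term vanishes.
\<close>

definition stieltjes_integral :: "(real \<Rightarrow> real) \<Rightarrow> (real \<Rightarrow> complex) \<Rightarrow> complex" where
  "stieltjes_integral G g =
     (LINT y|interval_measure (right_limit (variation_upto G)). g y)
     - (LINT y|interval_measure (right_limit (\<lambda>x. variation_upto G x - G x)). g y)"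

definition fourier_stieltjes :: "(real \<Rightarrow> real) \<Rightarrow> real \<Rightarrow> complex" where
  "fourier_stieltjes G t = stieltjes_integral G (\<lambda>y. exp (- (\<i> * of_real t * of_real y)))"

definition fejer_density :: "real \<Rightarrow> real" where
  "fejer_density y = (if y = 0 then 1 / (2 * pi) else 1 / (2 * pi) * (sin (y / 2) / (y / 2))\<^sup>2)"

text \<open>
  Integral along the arc of radius \<open>r\<close> about \<open>0\<close> from angle \<open>a\<close> to angle \<open>b\<close> of a function
  which need only be defined inside the open disc: the limit of the integrals along the
  concentric arcs of radius \<open>s < r\<close>. If the function extends continuously to the arc, this
  is the ordinary contour integral, as the lemma below shows.
\<close>

definition boundary_arc_integral ::
    "real \<Rightarrow> real \<Rightarrow> real \<Rightarrow> (complex \<Rightarrow> complex) \<Rightarrow> complex" where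
  "boundary_arc_integral r a b g =
     Lim (at_left r) (\<lambda>s. contour_integral (part_circlepath 0 s a b) g)"

text \<open>Both semicircles run from \<open>-r\<close> to \<open>r\<close>.\<close>

definition lower_semicircle_integral :: "real \<Rightarrow> (complex \<Rightarrow> complex) \<Rightarrow> complex" where
  "lower_semicircle_integral r g = boundary_arc_integral r pi (2 * pi) g"

definition upper_semicircle_integral :: "real \<Rightarrow> (complex \<Rightarrow> complex) \<Rightarrow> complex" where
  "upper_semicircle_integral r g = boundary_arc_integral r pi 0 g"

lemma boundary_arc_integral_eq_contour_integral:
  assumes "0 \<le> s0" "s0 < r"
    and cont: "continuous_on {z. s0 \<le> cmod z \<and> cmod z \<le> r} g"
  shows "boundary_arc_integral r a b g = contour_integral (part_circlepath 0 r a b) g"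
proof -
  define k where "k s x = g (of_real s * exp (\<i> * of_real (linepath a b x)))
      * (\<i> * of_real s * (of_real b - of_real a) * exp (\<i> * of_real (linepath a b x)))" for s x
  have eq: "contour_integral (part_circlepath 0 s a b) g = integral (cbox 0 1) (k s)" for s
    unfolding contour_integral_integral vector_derivative_part_circlepath k_def
    by (simp add: part_circlepath_def)
  have "continuous_on ({s0..r} \<times> cbox 0 1) (\<lambda>(s, x). k s x)"
    unfolding k_def split_def linepath_def
    using assms
    by (intro continuous_intros continuous_on_compose2[OF cont])
       (auto simp: norm_mult simp flip: of_real_mult of_real_add of_real_diff)
  from integral_continuous_on_param[OF this]
  have "((\<lambda>s. integral (cbox 0 1) (k s)) \<longlongrightarrow> integral (cbox 0 1) (k r)) (at r within {s0..r})"
    using assms by (auto simp: continuous_on)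
  moreover have "at r within {s0..r} = at_left r"
    using assms(2) by (rule at_within_Icc_at_left)
  ultimately show ?thesis
    unfolding boundary_arc_integral_def eq by (intro tendsto_Lim) auto
qed

end

theory Submission
  imports Defs "HOL-Probability.Probability"
begin

text \<open>
  By Cauchy's theorem each semicircle integral equals
  \<open>I x = \<integral> t = -r..r. (f t - h t) / t * exp (\<i> t x)\<close> with \<open>x = y \<plusminus> b / T\<close>, where
  \<open>f 0 = h 0\<close> because \<open>F\<close> and \<open>H\<close> have equal limits. Convolve \<open>F - H\<close> with the rescaled
  kernel \<open>T * fejer_density (T * u)\<close>, whose Fourier transform is the tent
  \<open>max 0 (1 - |t| / T)\<close>. The convolution at \<open>x\<close> is an inversion integral over
  \<open>[-T, T]\<close>, bounded by \<open>I x\<close>, the integral over \<open>r \<le> |t| \<le> T\<close>, and the defect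
  \<open>|t| / T\<close> of the tent on \<open>[-r, r]\<close>. Conversely, if \<open>F - H\<close> is close to plus (minus) its
  supremum \<open>\<delta>\<close> in absolute value at \<open>y\<close>, then by monotonicity of \<open>F\<close> and the Lipschitz
  bound on \<open>H\<close> it stays so on the interval of length \<open>2 b / T\<close> to the right (left) of
  \<open>y\<close>. This interval carries \<open>3/4\<close> of the kernel centred at its midpoint, so the
  convolution there is at least about \<open>3/4 \<delta> - 1/4 \<delta>\<close> in absolute value.
\<close>

subsection \<open>Stieltjes measures of functions of bounded variation\<close>

lemma tendsto_right_limit:
  assumes "mono G"
  shows "(G \<longlongrightarrow> right_limit G x) (at_right x)"
proof -
  have "(G \<longlongrightarrow> Inf (G ` ({x<..} \<inter> UNIV))) (at x within ({x<..} \<inter> UNIV))"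
    by (rule Lim_right_bound[where K = "G x"]) (auto intro: monoD[OF assms])
  then show ?thesis
    unfolding right_limit_def by (simp add: tendsto_Lim)
qed

lemma right_limit_ge:
  assumes "mono G" "x \<le> y"
  shows "G x \<le> right_limit G y"
proof (rule tendsto_lowerbound[OF tendsto_right_limit[OF assms(1)]])
  show "\<forall>\<^sub>F z in at_right y. G x \<le> G z"
    using eventually_at_right_less[of y] by eventually_elim (use assms in \<open>auto intro: monoD\<close>)
qed simp

lemma right_limit_le:
  assumes "mono G" "x < y"
  shows "right_limit G x \<le> G y"
proof (rule tendsto_upperbound[OF tendsto_right_limit[OF assms(1)]])
  show "\<forall>\<^sub>F z in at_right x. G z \<le> G y"
    using eventually_at_right_less[of x] eventually_at_right_real[OF assms(2)]
    by eventually_elim (use assms(1) in \<open>auto intro: monoD\<close>)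
qed simp

lemma mono_right_limit:
  assumes "mono G"
  shows "mono (right_limit G)"
proof (rule monoI)
  fix x y :: real assume "x \<le> y"
  then show "right_limit G x \<le> right_limit G y"
    using right_limit_le[OF assms, of x y] right_limit_ge[OF assms, of y y] by (cases "x = y") auto
qed

lemma continuous_right_limit:
  assumes "mono G"
  shows "continuous (at_right a) (right_limit G)"
  unfolding continuous_within
proof (rule order_tendstoI)
  fix u assume "right_limit G a < u"
  then have "\<forall>\<^sub>F z in at_right a. G z < u"
    using tendsto_right_limit[OF assms] by (rule order_tendstoD(2)[rotated])
  then obtain b where b: "a < b" "\<And>z. a < z \<Longrightarrow> z < b \<Longrightarrow> G z < u"
    by (auto simp: eventually_at_right_field)
  show "\<forall>\<^sub>F z in at_right a. right_limit G z < u"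
    using eventually_at_right_real[OF b(1)]
  proof eventually_elim
    \<comment> \<open>The midpoint of \<open>z\<close> and \<open>b\<close> lies to the right of
      \<open>z\<close>, so monotonicity puts \<open>right_limit G z\<close> below the value of
      \<open>G\<close> there, which is less than \<open>u\<close>.\<close>
    fix z assume "z \<in> {a<..<b}"
    then show "right_limit G z < u"
      using right_limit_le[OF assms, of z "(z + b) / 2"] b(2)[of "(z + b) / 2"] by auto
  qed
next
  fix l assume "l < right_limit G a"
  then have "l < right_limit G z" if "a < z" for z
    using that monoD[OF mono_right_limit[OF assms], of a z] by simp
  then show "\<forall>\<^sub>F z in at_right a. l < right_limit G z"
    using eventually_at_right_less[of a] by (auto elim: eventually_mono)
qed

text \<open>Monotonicity squeezes \<open>right_limit G x\<close> between \<open>G x\<close> and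
  \<open>G (x + 1)\<close>; the same squeeze serves at the left end.\<close>

lemma right_limit_at_top:
  assumes "mono G" "(G \<longlongrightarrow> l) at_top"
  shows "(right_limit G \<longlongrightarrow> l) at_top"
proof (rule tendsto_sandwich[OF _ _ assms(2)])
  show "((\<lambda>x. G (x + 1)) \<longlongrightarrow> l) at_top"
    by (rule filterlim_compose[OF assms(2)]) real_asymp
qed (auto intro!: always_eventually right_limit_ge right_limit_le assms)

lemma right_limit_at_bot:
  assumes "mono G" "(G \<longlongrightarrow> l) at_bot"
  shows "(right_limit G \<longlongrightarrow> l) at_bot"
proof (rule tendsto_sandwich[OF _ _ assms(2)])
  show "((\<lambda>x. G (x + 1)) \<longlongrightarrow> l) at_bot"
    by (rule filterlim_compose[OF assms(2)]) real_asymp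
qed (auto intro!: always_eventually right_limit_ge right_limit_le assms)

lemma mono_bounded_limits:
  fixes G :: "real \<Rightarrow> real"
  assumes "mono G" "\<And>x. \<bar>G x\<bar> \<le> B"
  obtains l u where "(G \<longlongrightarrow> l) at_bot" "(G \<longlongrightarrow> u) at_top"
proof -
  have up: "\<exists>u. (K \<longlongrightarrow> u) at_top" if K: "mono K" "\<And>x. \<bar>K x\<bar> \<le> B" for K :: "real \<Rightarrow> real"
  proof -
    have "incseq (\<lambda>n. K (real n))"
      using K(1) by (auto simp: incseq_def mono_def)
    moreover have "bdd_above (range (\<lambda>n. K (real n)))"
      using K(2) by (intro bdd_aboveI2[of _ _ B]) (simp add: abs_le_iff)
    ultimately have "(\<lambda>n. K (real n)) \<longlonglongrightarrow> (SUP n. K (real n))"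
      by (rule LIMSEQ_incseq_SUP[rotated])
    then show ?thesis
      using K(1) by (intro exI tendsto_at_topI_sequentially_real) (auto simp: mono_def)
  qed
  from up[OF assms] obtain u where u: "(G \<longlongrightarrow> u) at_top" by blast
  \<comment> \<open>The limit at the left end comes from the one at the right end of the reflected
    function, which is again nondecreasing.\<close>
  have "mono (\<lambda>x. - G (- x))" using assms(1) by (auto simp: mono_def)
  from up[OF this] assms(2) obtain l where "((\<lambda>x. - G (- x)) \<longlongrightarrow> l) at_top" by auto
  then have "((\<lambda>x. G (- x)) \<longlongrightarrow> - l) at_top"
    using tendsto_minus by fastforce
  from filterlim_compose[OF this filterlim_uminus_at_top_at_bot] have "(G \<longlongrightarrow> - l) at_bot"
    by simp
  with u show ?thesis using that by blast
qed

lemma interval_measure_right_limit: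
  assumes "mono G" "(G \<longlongrightarrow> l) at_bot" "(G \<longlongrightarrow> u) at_top"
  shows "finite_borel_measure (interval_measure (right_limit G))"
    and "cdf (interval_measure (right_limit G)) x = right_limit G x - l"
proof -
  let ?R = "right_limit G"
  note R = mono_right_limit[OF assms(1)] continuous_right_limit[OF assms(1)]
    right_limit_at_top[OF assms(1,3)] right_limit_at_bot[OF assms(1,2)]
  \<comment> \<open>\<open>finite_borel_measure_interval_measure\<close> asks for the limit
    \<open>0\<close> at the left end. Subtracting \<open>l\<close> provides it and leaves all
    increments, hence the measure, unchanged.\<close>
  have eq: "interval_measure (\<lambda>x. ?R x - l) = interval_measure ?R"
    by (simp add: interval_measure_def)
  have "l \<le> G 0"
    by (rule tendsto_upperbound[OF assms(2)])
       (rule eventually_mono[OF eventually_le_at_bot[of 0]], auto intro: monoD[OF assms(1)])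
  moreover have "G 0 \<le> u"
    by (rule tendsto_lowerbound[OF assms(3)])
       (rule eventually_mono[OF eventually_ge_at_top[of 0]], auto intro: monoD[OF assms(1)])
  ultimately have lu: "l \<le> u" by simp
  show fin: "finite_borel_measure (interval_measure ?R)"
    unfolding eq[symmetric]
    by (rule finite_borel_measure_interval_measure[where m = "u - l"])
       (use R lu in \<open>auto intro!: tendsto_eq_intros continuous_intros dest: monoD\<close>)
  interpret finite_borel_measure "interval_measure ?R" by fact
  \<comment> \<open>The measures of the intervals \<open>{y<..x}\<close> are known; sending
    \<open>y\<close> to the left end turns them into values of the cdf.\<close>
  have ev: "\<forall>\<^sub>F y in at_bot. cdf (interval_measure ?R) x - cdf (interval_measure ?R) y = ?R x - ?R y"
    using eventually_gt_at_bot[of x]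
  proof eventually_elim
    fix y assume "y < x"
    then have "emeasure (interval_measure ?R) {y<..x} = ?R x - ?R y"
      using R by (intro emeasure_interval_measure_Ioc) (auto dest: monoD)
    then show "cdf (interval_measure ?R) x - cdf (interval_measure ?R) y = ?R x - ?R y"
      using \<open>y < x\<close> R(1) by (simp add: cdf_diff_eq measure_def monoD)
  qed
  have "((\<lambda>y. cdf (interval_measure ?R) x - cdf (interval_measure ?R) y) \<longlongrightarrow>
          cdf (interval_measure ?R) x - 0) at_bot"
    by (intro tendsto_intros cdf_lim_at_bot)
  from Lim_transform_eventually[OF this ev]
  have "((\<lambda>y. ?R x - ?R y) \<longlongrightarrow> cdf (interval_measure ?R) x) at_bot" by simp
  moreover have "((\<lambda>y. ?R x - ?R y) \<longlongrightarrow> ?R x - l) at_bot"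
    by (intro tendsto_intros R)
  ultimately show "cdf (interval_measure ?R) x = ?R x - l"
    by (rule tendsto_unique[rotated]) simp
qed

section \<open>Total variation and the Jordan decomposition\<close>

lemma variation_sums_nonempty: "0 \<in> variation_sums G {..x}"
  unfolding variation_sums_def
  by (rule CollectI, rule exI[of _ "\<lambda>_. x"], rule exI[of _ 0]) (auto simp: mono_def)

lemma variation_sums_mono: "A \<subseteq> B \<Longrightarrow> variation_sums G A \<subseteq> variation_sums G B"
  unfolding variation_sums_def by blast

lemma bdd_above_variation_sums:
  "bounded_variation G \<Longrightarrow> bdd_above (variation_sums G A)"
  unfolding bounded_variation_def
  by (erule bdd_above_mono) (rule variation_sums_mono, simp)

text \<open>Appending \<open>x\<close> and then \<open>y\<close> to a partition adds the increment
  between them. The point \<open>x\<close> is inserted because the partition may stop short of it,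
  and the tail is made constant because \<open>p\<close> is uncontrolled beyond index
  \<open>n\<close>.\<close>

lemma variation_sums_extend:
  assumes "s \<in> variation_sums G {..x}" "x \<le> y"
  shows "\<exists>s'\<in>variation_sums G {..y}. s + \<bar>G y - G x\<bar> \<le> s'"
proof -
  obtain p n where p: "mono p" "p ` {..n} \<subseteq> {..x}" "s = (\<Sum>i<n. \<bar>G (p (Suc i)) - G (p i)\<bar>)"
    using assms(1) unfolding variation_sums_def by blast
  define q where "q i = (if i \<le> n then p i else if i = Suc n then x else y)" for i
  have pn: "p i \<le> x" if "i \<le> n" for i using p(2) that by auto
  have "mono q"
    unfolding q_def using p(1) pn assms(2) by (auto simp: mono_def) (meson order_trans)
  moreover have "q ` {..Suc (Suc n)} \<subseteq> {..y}"
    using pn assms(2) by (auto simp: q_def intro: order_trans)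
  moreover have "(\<Sum>i<Suc (Suc n). \<bar>G (q (Suc i)) - G (q i)\<bar>)
      = s + \<bar>G x - G (p n)\<bar> + \<bar>G y - G x\<bar>"
    by (simp add: q_def p(3))
  ultimately have "s + \<bar>G x - G (p n)\<bar> + \<bar>G y - G x\<bar> \<in> variation_sums G {..y}"
    unfolding variation_sums_def by (metis (mono_tags, lifting) mem_Collect_eq)
  then show ?thesis by (rule bexI[rotated]) simp
qed

text \<open>This is the inequality behind the Jordan decomposition: it makes both
  \<open>variation_upto G\<close> and its difference with \<open>G\<close> nondecreasing.\<close>

lemma variation_upto_diff:
  assumes "bounded_variation G" "x \<le> y"
  shows "variation_upto G x + \<bar>G y - G x\<bar> \<le> variation_upto G y"
proof -
  have "variation_upto G x \<le> variation_upto G y - \<bar>G y - G x\<bar>"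
    unfolding variation_upto_def
  proof (rule cSup_least)
    fix s assume "s \<in> variation_sums G {..x}"
    from variation_sums_extend[OF this assms(2)] obtain s' where
      "s' \<in> variation_sums G {..y}" "s + \<bar>G y - G x\<bar> \<le> s'" by blast
    then show "s \<le> Sup (variation_sums G {..y}) - \<bar>G y - G x\<bar>"
      using cSup_upper[OF _ bdd_above_variation_sums[OF assms(1)], of s' "{..y}"] by linarith
  qed (use variation_sums_nonempty in blast)
  then show ?thesis by simp
qed

lemma bounded_variation_upto:
  assumes "bounded_variation G"
  obtains B where "\<And>x. \<bar>variation_upto G x\<bar> \<le> B"
proof -
  obtain B where B: "\<And>s. s \<in> variation_sums G UNIV \<Longrightarrow> s \<le> B"
    using assms unfolding bounded_variation_def bdd_above_def by blast
  have "variation_upto G x \<le> B" for x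
    unfolding variation_upto_def
    by (rule cSup_least)
       (use variation_sums_nonempty variation_sums_mono[of "{..x}" UNIV G] B in blast)+
  moreover have "0 \<le> variation_upto G x" for x
    unfolding variation_upto_def
    by (rule cSup_upper[OF variation_sums_nonempty bdd_above_variation_sums[OF assms]])
  ultimately show ?thesis
    by (intro that[of B]) auto
qed

lemma mono_bounded_variation:
  assumes "mono G" "\<And>x. \<bar>G x\<bar> \<le> B"
  shows "bounded_variation G"
  unfolding bounded_variation_def
proof (rule bdd_aboveI[of _ "2 * B"])
  fix s assume "s \<in> variation_sums G UNIV"
  then obtain p n where p: "mono p" "s = (\<Sum>i<n. \<bar>G (p (Suc i)) - G (p i)\<bar>)"
    unfolding variation_sums_def by blast
  have "s = (\<Sum>i<n. G (p (Suc i)) - G (p i))"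
    unfolding p(2) using monoD[OF assms(1) monoD[OF p(1)]] by (intro sum.cong) (auto simp: le_Suc_eq)
  also have "\<dots> = G (p n) - G (p 0)" by (rule sum_lessThan_telescope)
  finally show "s \<le> 2 * B" using assms(2)[of "p n"] assms(2)[of "p 0"] by (simp add: abs_le_iff)
qed

lemma bounded_variation_bounded:
  assumes "bounded_variation G"
  obtains B where "\<And>x. \<bar>G x\<bar> \<le> B"
proof -
  obtain C where C: "\<And>x. \<bar>variation_upto G x\<bar> \<le> C"
    using bounded_variation_upto[OF assms] by blast
  have "\<bar>G x\<bar> \<le> \<bar>G 0\<bar> + 2 * C" for x
    using variation_upto_diff[OF assms, of x 0] variation_upto_diff[OF assms, of 0 x]
      C[of 0] C[of x] by (cases "x \<le> 0") (auto simp: abs_le_iff)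
  then show ?thesis using that by blast
qed

definition fourier :: "real measure \<Rightarrow> real \<Rightarrow> complex" where
  "fourier P t = (LINT y|P. exp (- (\<i> * of_real t * of_real y)))"

text \<open>Interval measures see only right limits, so \<open>G\<close> is recovered only in that
  sense from the two Jordan measures. The additive constant that the measures lose is the limit
  \<open>m\<close>.\<close>

lemma bounded_variation_measures:
  assumes "bounded_variation G" "(G \<longlongrightarrow> m) at_bot"
  obtains P N where "finite_borel_measure P" "finite_borel_measure N"
    "\<And>t. fourier_stieltjes G t = fourier P t - fourier N t"
    "\<And>x. (G \<longlongrightarrow> m + cdf P x - cdf N x) (at_right x)"
proof -
  let ?V = "variation_upto G" and ?W = "\<lambda>x. variation_upto G x - G x"
  have mV: "mono ?V"
    using variation_upto_diff[OF assms(1)] by (intro monoI) (smt (verit))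
  have mW: "mono ?W"
    using variation_upto_diff[OF assms(1)] by (intro monoI) (smt (verit))
  obtain B where B: "\<And>x. \<bar>?V x\<bar> \<le> B" using bounded_variation_upto[OF assms(1)] by blast
  obtain C where C: "\<And>x. \<bar>G x\<bar> \<le> C" using bounded_variation_bounded[OF assms(1)] by blast
  have BC: "\<bar>?W x\<bar> \<le> B + C" for x using B[of x] C[of x] by linarith
  obtain v v' where v: "(?V \<longlongrightarrow> v) at_bot" "(?V \<longlongrightarrow> v') at_top" using mono_bounded_limits[OF mV B] .
  obtain w w' where w: "(?W \<longlongrightarrow> w) at_bot" "(?W \<longlongrightarrow> w') at_top" using mono_bounded_limits[OF mW BC] .
  have "((\<lambda>x. ?V x - G x) \<longlongrightarrow> v - m) at_bot" by (intro tendsto_intros v assms)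
  then have wm: "w = v - m" using w(1) by (intro tendsto_unique[OF _ w(1)]) auto
  let ?P = "interval_measure (right_limit ?V)" and ?N = "interval_measure (right_limit ?W)"
  have "(G \<longlongrightarrow> m + cdf ?P x - cdf ?N x) (at_right x)" for x
  proof -
    have "((\<lambda>x. ?V x - ?W x) \<longlongrightarrow> right_limit ?V x - right_limit ?W x) (at_right x)"
      by (intro tendsto_diff tendsto_right_limit mV mW)
    then show ?thesis
      by (simp add: interval_measure_right_limit(2)[OF mV v] interval_measure_right_limit(2)[OF mW w] wm)
  qed
  then show ?thesis
    using interval_measure_right_limit(1)[OF mV v] interval_measure_right_limit(1)[OF mW w]
    by (intro that[of ?P ?N])
       (auto simp: fourier_stieltjes_def stieltjes_integral_def fourier_def)
qed

subsection \<open>The Fejer kernel\<close>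

lemma fejer_density_sinc: "fejer_density y = 1 / (2 * pi) * (sinc (y / 2))\<^sup>2"
  by (simp add: fejer_density_def)

lemma fejer_density_nonneg: "0 \<le> fejer_density y"
  by (simp add: fejer_density_sinc)

lemma isCont_fejer_density: "isCont fejer_density y"
  unfolding fejer_density_sinc[abs_def]
  by (intro continuous_intros continuous_within_compose3[OF isCont_sinc]) auto

lemma fejer_density_measurable [measurable]: "fejer_density \<in> borel_measurable borel"
  by (intro borel_measurable_continuous_onI continuous_at_imp_continuous_on ballI isCont_fejer_density)

lemma sinc_le_1: "\<bar>sinc x\<bar> \<le> 1"
  using abs_sin_x_le_abs_x[of x] by (auto simp: divide_le_eq_1)

lemma fejer_density_le: "fejer_density y \<le> 1"
proof -
  have "(sinc (y / 2))\<^sup>2 \<le> 1" using sinc_le_1[of "y / 2"] by (simp add: abs_square_le_1)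
  then have "fejer_density y \<le> 1 / (2 * pi) * 1"
    unfolding fejer_density_sinc by (intro mult_left_mono) auto
  also have "\<dots> \<le> 1" using pi_gt3 by simp
  finally show ?thesis .
qed

text \<open>
  Writing the boundary term \<open>2 (sin (y/2))\<^sup>2 / y\<close> as \<open>sin (y/2) * sinc (y/2)\<close> makes the
  antiderivative valid at \<open>0\<close> as well.
\<close>

lemma fejer_antiderivative:
  "((\<lambda>y. 1 / pi * (Si y - sin (y / 2) * sinc (y / 2))) has_real_derivative fejer_density y) (at y)"
proof -
  have "((\<lambda>y. sin (y / 2) * sinc (y / 2)) has_real_derivative sinc y - (sinc (y / 2))\<^sup>2 / 2) (at y)"
  proof (cases "y = 0")
    \<comment> \<open>At the origin the difference quotient is half the square of
      \<open>sinc (y / 2)\<close>; its limit \<open>1/2\<close> agrees with the claimed derivative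
      \<open>1 - 1/2\<close>.\<close>
    case True
    have "((\<lambda>y. (1/2) * (sinc (y / 2) * sinc (y / 2))) \<longlongrightarrow> (1/2) * (sinc (0 / 2) * sinc (0 / 2))) (at 0)"
      by (intro isContD continuous_intros continuous_within_compose3[OF isCont_sinc]) auto
    then have "((\<lambda>y. (sin (y / 2) * sinc (y / 2)) / y) \<longlongrightarrow> 1/2) (at 0)"
      by (rule tendsto_eq_rhs[OF Lim_transform_eventually]) (auto simp: eventually_at_filter)
    then show ?thesis
      using True by (simp add: has_field_derivative_iff)
  next
    case False
    have "((\<lambda>y. 2 * (sin (y / 2))\<^sup>2 / y) has_real_derivative sinc y - (sinc (y / 2))\<^sup>2 / 2) (at y)"
      using False sin_double[of "y / 2"]
      by (auto intro!: derivative_eq_intros simp: field_simps power2_eq_square)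
    moreover have "\<forall>\<^sub>F z in nhds y. z \<noteq> 0" using False by (rule t1_space_nhds)
    then have "\<forall>\<^sub>F z in nhds y. 2 * (sin (z / 2))\<^sup>2 / z = sin (z / 2) * sinc (z / 2)"
      by eventually_elim (simp add: power2_eq_square)
    ultimately show ?thesis by (subst (asm) DERIV_cong_ev[OF refl _ refl]) auto
  qed
  from DERIV_cmult[OF DERIV_diff[OF DERIV_Si[of y] this], of "1 / pi"]
  show ?thesis by (simp add: fejer_density_sinc field_simps)
qed

lemma fejer_antiderivative_at_top:
  "((\<lambda>y. 1 / pi * (Si y - sin (y / 2) * sinc (y / 2))) \<longlongrightarrow> 1 / 2) at_top"
proof -
  have "((\<lambda>y::real. 2 / y) \<longlongrightarrow> 0) at_top" by real_asymp
  moreover have "\<forall>\<^sub>F y in at_top. norm (sin (y / 2) * sinc (y / 2)) \<le> 2 / y"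
    using eventually_gt_at_top[of 0]
  proof eventually_elim
    fix y :: real assume "0 < y"
    moreover have "\<bar>sin (y / 2)\<bar> * \<bar>sin (y / 2)\<bar> \<le> 1"
      by (intro mult_le_one) auto
    ultimately show "norm (sin (y / 2) * sinc (y / 2)) \<le> 2 / y"
      by (simp add: abs_mult field_simps)
  qed
  ultimately have "((\<lambda>y. sin (y / 2) * sinc (y / 2)) \<longlongrightarrow> 0) at_top"
    by (rule Lim_null_comparison[rotated])
  then have "((\<lambda>y. 1 / pi * (Si y - sin (y / 2) * sinc (y / 2))) \<longlongrightarrow> 1 / pi * (pi / 2 - 0)) at_top"
    by (intro tendsto_intros Si_at_top)
  then show ?thesis by simp
qed

text \<open>The antiderivative is odd, so this is the reflection of the limit at the other
  end.\<close>

lemma fejer_antiderivative_at_bot: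
  "((\<lambda>y. 1 / pi * (Si y - sin (y / 2) * sinc (y / 2))) \<longlongrightarrow> - (1 / 2)) at_bot"
proof -
  have "((\<lambda>y. - (1 / pi * (Si (- y) - sin (- y / 2) * sinc (- y / 2)))) \<longlongrightarrow> - (1 / 2)) at_bot"
    by (intro tendsto_minus filterlim_compose[OF fejer_antiderivative_at_top filterlim_uminus_at_top_at_bot])
  moreover have "\<forall>\<^sub>F y in at_bot. - (1 / pi * (Si (- y) - sin (- y / 2) * sinc (- y / 2)))
      = 1 / pi * (Si y - sin (y / 2) * sinc (y / 2))"
    using eventually_le_at_bot[of 0]
  proof eventually_elim
    fix y :: real assume "y \<le> 0"
    then show "- (1 / pi * (Si (- y) - sin (- y / 2) * sinc (- y / 2)))
      = 1 / pi * (Si y - sin (y / 2) * sinc (y / 2))"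
      using Si_neg[of "- y"] by (simp add: field_simps)
  qed
  ultimately show ?thesis by (rule Lim_transform_eventually)
qed

text \<open>Since the density is nonnegative, the improper fundamental theorem yields integrability
  together with the mass \<open>1/2 - (- (1/2))\<close>.\<close>

lemma fejer_density_integral:
  shows integrable_fejer_density: "integrable lborel fejer_density"
    and integral_fejer_density: "(LBINT y. fejer_density y) = 1"
proof -
  note FTC = interval_integral_FTC_nonneg[of "-\<infinity>" "\<infinity>" "\<lambda>y. 1 / pi * (Si y - sin (y / 2) * sinc (y / 2))"
      fejer_density "- (1/2)" "1/2", OF _ fejer_antiderivative isCont_fejer_density]
  have "set_integrable lborel (einterval (-\<infinity>) \<infinity>) fejer_density"
    using fejer_antiderivative_at_top fejer_antiderivative_at_bot
    by (intro FTC) (auto simp: fejer_density_nonneg ereal_tendsto_simps)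
  then show "integrable lborel fejer_density" by (simp add: set_integrable_def)
  have "(LBINT y=-\<infinity>..\<infinity>. fejer_density y) = 1/2 - (- (1/2))"
    using fejer_antiderivative_at_top fejer_antiderivative_at_bot
    by (intro FTC) (auto simp: fejer_density_nonneg ereal_tendsto_simps)
  then show "(LBINT y. fejer_density y) = 1"
    by (simp add: interval_lebesgue_integral_def set_lebesgue_integral_def)
qed

section \<open>The tent function and its Fourier transform\<close>

definition tent :: "real \<Rightarrow> real \<Rightarrow> real" where
  "tent T t = max 0 (1 - \<bar>t\<bar> / T)"

lemma tent_measurable [measurable]: "tent T \<in> borel_measurable borel"
  unfolding tent_def[abs_def] by measurable

lemma tent_bounds:
  assumes "T > 0"
  shows "0 \<le> tent T t" "tent T t \<le> 1" "tent T t \<le> indicator {-T..T} t"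
  using assms by (auto simp: tent_def field_simps split: split_indicator)

text \<open>Going from the tent to the kernel, rather than back, keeps the computation on a bounded
  interval: elementary antiderivatives on the two linear pieces suffice.\<close>

lemma fourier_tent:
  assumes "T > 0"
  shows "integrable lborel (\<lambda>t. of_real (tent T t) * exp (\<i> * of_real t * of_real u))" (is ?int)
    and "(LBINT t. of_real (tent T t) * exp (\<i> * of_real t * of_real u))
       = of_real (2 * pi * (T * fejer_density (T * u)))" (is ?eq)
proof -
  let ?e = "\<lambda>t. exp (\<i> * of_real t * of_real u)"
  have L: "has_bochner_integral lborel (\<lambda>t. indicator {-T..0} t *\<^sub>R ((1 + of_real t / of_real T) * ?e t))
     (if u = 0 then of_real (T / 2) else - \<i> / of_real u + 1 / of_real (T * u^2) - ?e (-T) / of_real (T * u^2))"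
  \<comment> \<open>The general antiderivative divides by \<open>u\<close>, so the zero frequency is
    integrated separately, with the exponential equal to \<open>1\<close>.\<close>
  proof (cases "u = 0")
    case True
    define E where "E t = complex_of_real (t + t^2 / (2 * T))" for t
    have "has_bochner_integral lborel (\<lambda>t. indicator {-T..0} t *\<^sub>R ((1 + of_real t / of_real T) * ?e t))
       (E 0 - E (-T))"
    proof (rule has_bochner_integral_FTC_Icc)
      fix t
      have "((\<lambda>t. t + t^2 / (2 * T)) has_real_derivative 1 + t / T) (at t within {-T..0})"
        using assms by (auto intro!: derivative_eq_intros simp: field_simps)
      from has_vector_derivative_of_real[where 'a = complex, OF this]
      have d: "(E has_vector_derivative of_real (1 + t / T)) (at t within {-T..0})"
        unfolding E_def[abs_def] .
      have e: "complex_of_real (1 + t / T) = (1 + of_real t / of_real T) * ?e t"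
        using True by simp
      show "(E has_vector_derivative (1 + of_real t / of_real T) * ?e t) (at t within {-T..0})"
        using d unfolding e .
    qed (use assms in \<open>auto intro!: continuous_intros\<close>)
    moreover have "E 0 - E (-T) = of_real (T / 2)"
      using assms by (simp add: E_def power2_eq_square)
    ultimately show ?thesis using True by simp
  next
    case False
    define E where "E z = (1 + z / of_real T) * exp (\<i> * z * of_real u) / (\<i> * of_real u)
      + exp (\<i> * z * of_real u) / of_real (T * u^2)" for z
    have "has_bochner_integral lborel (\<lambda>t. indicator {-T..0} t *\<^sub>R ((1 + of_real t / of_real T) * ?e t))
       ((\<lambda>t. E (of_real t)) 0 - (\<lambda>t. E (of_real t)) (-T))"
    proof (rule has_bochner_integral_FTC_Icc[where F = "\<lambda>t. E (of_real t)"])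
      fix t
      have "(E has_field_derivative (1 + of_real t / of_real T) * ?e t) (at (of_real t))"
        unfolding E_def[abs_def] using assms False
        by (auto intro!: derivative_eq_intros simp: field_simps power2_eq_square)
      from has_vector_derivative_real_field[OF this]
      show "((\<lambda>t. E (of_real t)) has_vector_derivative (1 + of_real t / of_real T) * ?e t) (at t within {-T..0})"
        by (auto intro: has_vector_derivative_at_within)
    qed (use assms in \<open>auto intro!: continuous_intros\<close>)
    moreover have "E (of_real 0) - E (of_real (-T)) = - \<i> / of_real u + 1 / of_real (T * u^2) - ?e (-T) / of_real (T * u^2)"
      using assms False by (simp add: E_def field_simps)
    ultimately show ?thesis using False by simp
  qed
  have R: "has_bochner_integral lborel (\<lambda>t. indicator {0..T} t *\<^sub>R ((1 - of_real t / of_real T) * ?e t))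
     (if u = 0 then of_real (T / 2) else \<i> / of_real u + 1 / of_real (T * u^2) - ?e T / of_real (T * u^2))"
  proof (cases "u = 0")
    case True
    define E where "E t = complex_of_real (t - t^2 / (2 * T))" for t
    have "has_bochner_integral lborel (\<lambda>t. indicator {0..T} t *\<^sub>R ((1 - of_real t / of_real T) * ?e t))
       (E T - E 0)"
    proof (rule has_bochner_integral_FTC_Icc)
      fix t
      have "((\<lambda>t. t - t^2 / (2 * T)) has_real_derivative 1 - t / T) (at t within {0..T})"
        using assms by (auto intro!: derivative_eq_intros simp: field_simps)
      from has_vector_derivative_of_real[where 'a = complex, OF this]
      have d: "(E has_vector_derivative of_real (1 - t / T)) (at t within {0..T})"
        unfolding E_def[abs_def] .
      have e: "complex_of_real (1 - t / T) = (1 - of_real t / of_real T) * ?e t"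
        using True by simp
      show "(E has_vector_derivative (1 - of_real t / of_real T) * ?e t) (at t within {0..T})"
        using d unfolding e .
    qed (use assms in \<open>auto intro!: continuous_intros\<close>)
    moreover have "E T - E 0 = of_real (T / 2)"
      using assms by (simp add: E_def power2_eq_square)
    ultimately show ?thesis using True by simp
  next
    case False
    define E where "E z = (1 - z / of_real T) * exp (\<i> * z * of_real u) / (\<i> * of_real u)
      - exp (\<i> * z * of_real u) / of_real (T * u^2)" for z
    have "has_bochner_integral lborel (\<lambda>t. indicator {0..T} t *\<^sub>R ((1 - of_real t / of_real T) * ?e t))
       ((\<lambda>t. E (of_real t)) T - (\<lambda>t. E (of_real t)) 0)"
    proof (rule has_bochner_integral_FTC_Icc[where F = "\<lambda>t. E (of_real t)"])
      fix t
      have "(E has_field_derivative (1 - of_real t / of_real T) * ?e t) (at (of_real t))"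
        unfolding E_def[abs_def] using assms False
        by (auto intro!: derivative_eq_intros simp: field_simps power2_eq_square)
      from has_vector_derivative_real_field[OF this]
      show "((\<lambda>t. E (of_real t)) has_vector_derivative (1 - of_real t / of_real T) * ?e t) (at t within {0..T})"
        by (auto intro: has_vector_derivative_at_within)
    qed (use assms in \<open>auto intro!: continuous_intros\<close>)
    moreover have "E (of_real T) - E (of_real 0) = \<i> / of_real u + 1 / of_real (T * u^2) - ?e T / of_real (T * u^2)"
      using assms False by (simp add: E_def field_simps)
    ultimately show ?thesis using False by simp
  qed
  \<comment> \<open>Both closed pieces contain \<open>0\<close>, where their sum is \<open>2\<close>
    instead of \<open>1\<close>; hence the equality holds only almost everywhere.\<close>
  have AE: "AE t in lborel. indicator {-T..0} t *\<^sub>R ((1 + of_real t / of_real T) * ?e t)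
      + indicator {0..T} t *\<^sub>R ((1 - of_real t / of_real T) * ?e t) = of_real (tent T t) * ?e t"
    using AE_lborel_singleton[of 0]
    by eventually_elim (use assms in \<open>auto simp: tent_def max_def field_simps split: split_indicator\<close>)
  have tot: "(if u = 0 then of_real (T / 2) else - \<i> / of_real u + 1 / of_real (T * u^2) - ?e (-T) / of_real (T * u^2))
    + (if u = 0 then of_real (T / 2) else \<i> / of_real u + 1 / of_real (T * u^2) - ?e T / of_real (T * u^2))
    = of_real (2 * pi * (T * fejer_density (T * u)))" (is "?l + ?r = _")
  proof (cases "u = 0")
    case False
    \<comment> \<open>The terms with \<open>\<i> / u\<close> cancel between the two pieces. The
      half-angle formula then turns \<open>2 - 2 * cos (T * u)\<close> into the square in the
      kernel.\<close>
    have "?l + ?r = of_real (2 / (T * u^2)) - (?e T + ?e (-T)) / of_real (T * u^2)"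
      using False by (simp add: add_divide_distrib)
    also have "?e T + ?e (-T) = of_real (2 * cos (T * u))"
      by (simp add: exp_Euler complex_eq_iff Re_exp Im_exp)
    also have "of_real (2 / (T * u^2)) - of_real (2 * cos (T * u)) / of_real (T * u^2)
      = (of_real ((2 - 2 * cos (T * u)) / (T * u^2)) :: complex)" 
      by (simp add: diff_divide_distrib)
    also have "cos (T * u) = 1 - 2 * (sin (T * u / 2))^2"
      using cos_double_sin[of "T * u / 2"] by simp
    finally show ?thesis using False assms
      by (simp add: fejer_density_def field_simps power2_eq_square)
  qed (simp add: fejer_density_def flip: of_real_add)
  have "has_bochner_integral lborel (\<lambda>t. of_real (tent T t) * ?e t)
      (of_real (2 * pi * (T * fejer_density (T * u))))"
    using has_bochner_integral_add[OF L R] unfolding tot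
    by (subst has_bochner_integral_cong_AE[OF _ _ AE, symmetric]) auto
  then show ?int ?eq by (simp_all add: has_bochner_integral_iff)
qed

subsection \<open>Convolution of distribution functions with the Fejer kernel\<close>

text \<open>On the product space the integrand is dominated by \<open>C\<close> times the norms of
  \<open>p\<close> and \<open>q\<close>. Separating a bounded factor \<open>k\<close> from two
  integrable ones gives a form that serves every exchange of integrals below.\<close>

lemma lebesgue_Fubini_bounded:
  fixes p :: "'a \<Rightarrow> complex" and q :: "'b \<Rightarrow> complex" and k :: "'a \<Rightarrow> 'b \<Rightarrow> complex"
  assumes "sigma_finite_measure A" "sigma_finite_measure B"
    and p: "integrable A p" and q: "integrable B q"
    and k[measurable]: "case_prod k \<in> borel_measurable (A \<Otimes>\<^sub>M B)"
    and bound: "\<And>x y. cmod (k x y) \<le> C"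
  shows "(LINT x|A. p x * (LINT y|B. q y * k x y)) = (LINT y|B. q y * (LINT x|A. p x * k x y))"
proof -
  interpret A: sigma_finite_measure A by fact
  interpret B: sigma_finite_measure B by fact
  interpret pair_sigma_finite A B ..
  have [measurable]: "p \<in> borel_measurable A" "q \<in> borel_measurable B"
    using p q by auto
  have C: "0 \<le> C" using bound[of undefined undefined] norm_ge_zero by (rule order_trans[rotated])
  have qk: "integrable B (\<lambda>y. p x * (q y * k x y))" if "x \<in> space A" for x
  proof (rule Bochner_Integration.integrable_bound)
    show "integrable B (\<lambda>y. cmod (p x) * C * norm (q y))"
      using q by (intro integrable_mult_right integrable_norm)
    show "(\<lambda>y. p x * (q y * k x y)) \<in> borel_measurable B" using that by measurable
    show "AE y in B. norm (p x * (q y * k x y)) \<le> norm (cmod (p x) * C * norm (q y))"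
      using C mult_left_mono[OF bound, of "cmod (p x) * cmod (q y)" x y for y]
      by (auto simp: norm_mult mult_ac)
  qed
  have "integrable (A \<Otimes>\<^sub>M B) (\<lambda>(x, y). p x * (q y * k x y))"
  proof (rule Fubini_integrable)
    show "integrable A (\<lambda>x. LINT y|B. norm (case (x, y) of (x, y) \<Rightarrow> p x * (q y * k x y)))"
    proof (rule Bochner_Integration.integrable_bound)
      show "integrable A (\<lambda>x. (C * (LINT y|B. cmod (q y))) * cmod (p x))"
        using p by (intro integrable_mult_right integrable_norm)
      have "(LINT y|B. norm (p x * (q y * k x y))) \<le> C * (LINT y|B. cmod (q y)) * cmod (p x)"
        if "x \<in> space A" for x
      proof -
        have "(LINT y|B. norm (p x * (q y * k x y))) \<le> (LINT y|B. (C * cmod (p x)) * cmod (q y))"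
        proof (rule integral_mono)
          show "norm (p x * (q y * k x y)) \<le> (C * cmod (p x)) * cmod (q y)" for y
            using mult_left_mono[OF bound[of x y], of "cmod (p x) * cmod (q y)"]
            by (simp add: norm_mult mult_ac)
        qed (use q qk[OF that] in auto)
        then show ?thesis by (simp add: mult_ac)
      qed
      then show "AE x in A. norm (LINT y|B. norm (case (x, y) of (x, y) \<Rightarrow> p x * (q y * k x y)))
          \<le> norm (C * (LINT y|B. cmod (q y)) * cmod (p x))"
        using C by (auto intro!: AE_I2 simp: abs_mult)
    qed measurable
  qed (use qk in auto)
  from Fubini_integral[OF this] show ?thesis
    by (simp add: mult_ac flip: integral_mult_right_zero)
qed

lemma integrable_indicator_Ioc:
  "integrable lborel (indicator {x1<..x2} :: real \<Rightarrow> complex)"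
proof -
  have "integrable lborel (\<lambda>s. indicator {x1<..x2} s *\<^sub>R (1::complex))"
    by (cases "x1 \<le> x2") (auto intro!: integrable_scaleR_left integrable_real_indicator)
  moreover have "(\<lambda>s. indicator {x1<..x2} s *\<^sub>R (1::complex)) = indicator {x1<..x2}"
    by (auto simp: fun_eq_iff indicator_def)
  ultimately show ?thesis by simp
qed

lemma fourier_measurable_kernel:
  "(\<lambda>(t, y). exp (\<i> * of_real t * of_real (s - y))) \<in> borel_measurable (borel \<Otimes>\<^sub>M borel)"
  by (intro borel_measurable_continuous_onI continuous_intros | simp add: split_def borel_prod)+

context finite_borel_measure
begin

lemma sigma_finite: "sigma_finite_measure M"
  by unfold_locales

text \<open>Dominated convergence: the exponentials have norm \<open>1\<close>, and constants are
  integrable for a finite measure.\<close>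

lemma isCont_fourier: "isCont (fourier M) t"
  unfolding continuous_at_sequentially comp_def fourier_def
proof safe
  fix X :: "nat \<Rightarrow> real" assume X: "X \<longlonglongrightarrow> t"
  show "(\<lambda>n. LINT y|M. exp (- (\<i> * of_real (X n) * of_real y))) \<longlonglongrightarrow>
      (LINT y|M. exp (- (\<i> * of_real t * of_real y)))"
    by (rule integral_dominated_convergence[where w = "\<lambda>_. 1"])
       (auto simp: measurable_cong_sets[OF M_is_borel refl] intro!: AE_I2 tendsto_intros X)
qed

lemma fourier_0: "fourier M 0 = of_real (measure M UNIV)"
  by (simp add: fourier_def borel_UNIV scaleR_conv_of_real)

lemma cdf_measurable [measurable]: "cdf M \<in> borel_measurable borel"
  by (rule borel_measurable_mono) (auto simp: mono_def cdf_nondecreasing)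

lemma abs_cdf_le: "\<bar>cdf M x\<bar> \<le> measure M UNIV"
  using cdf_nonneg cdf_bounded by (simp add: borel_UNIV)

lemma integrable_cdf_fejer:
  assumes "T > 0"
  shows "integrable lborel (\<lambda>u. cdf M (x - u) * (T * fejer_density (T * u)))"
proof (rule Bochner_Integration.integrable_bound)
  show "integrable lborel (\<lambda>u. (measure M UNIV * T) * fejer_density (T * u))"
    using lborel_integrable_real_affine[OF integrable_fejer_density, of T 0] assms
    by (intro integrable_mult_right) auto
  show "AE u in lborel. norm (cdf M (x - u) * (T * fejer_density (T * u)))
      \<le> norm (measure M UNIV * T * fejer_density (T * u))"
    using assms abs_cdf_le by (auto simp: abs_mult intro!: AE_I2 mult_right_mono)
qed measurable

text \<open>Inversion for the smoothed measure becomes an exchange of integrals once the kernel is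
  written as the transform of the tent.\<close>

lemma fejer_fourier:
  assumes "T > 0"
  shows "(LINT y|M. of_real (T * fejer_density (T * (s - y))))
     = (LBINT t. of_real (tent T t) * exp (\<i> * of_real t * of_real s) * fourier M t) / of_real (2 * pi)"
proof -
  have kernel: "(LINT y|M. exp (\<i> * of_real t * of_real (s - y))) = exp (\<i> * of_real t * of_real s) * fourier M t" for t
    unfolding fourier_def
    by (simp add: ring_distribs exp_add[symmetric] flip: integral_mult_right_zero)
  have "(LBINT t. of_real (tent T t) * (LINT y|M. 1 * exp (\<i> * of_real t * of_real (s - y))))
    = (LINT y|M. 1 * (LBINT t. of_real (tent T t) * exp (\<i> * of_real t * of_real (s - y))))"
  proof (rule lebesgue_Fubini_bounded[where C = 1])
    show "integrable lborel (\<lambda>t. complex_of_real (tent T t))"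
      using fourier_tent(1)[OF assms, of 0] by simp
    show "(\<lambda>(t, y). exp (\<i> * of_real t * of_real (s - y))) \<in> borel_measurable (lborel \<Otimes>\<^sub>M M)"
      using fourier_measurable_kernel
      by (simp add: measurable_cong_sets[OF sets_pair_measure_cong[OF sets_lborel M_is_borel] refl])
  qed (auto simp: sigma_finite lborel.sigma_finite_measure_axioms)
  also have "\<dots> = (LINT y|M. of_real (2 * pi) * of_real (T * fejer_density (T * (s - y))))"
    by (simp only: fourier_tent(2)[OF assms] of_real_mult mult_1_left)
  finally have "(LINT y|M. of_real (T * fejer_density (T * (s - y))) :: complex)
     = (LBINT t. of_real (tent T t) * (LINT y|M. exp (\<i> * of_real t * of_real (s - y)))) / of_real (2 * pi)"
    by (simp add: field_simps)
  then show ?thesis unfolding kernel by (simp only: mult.assoc)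
qed

text \<open>The convolved cdf is an antiderivative of the convolved measure. Increments turn the cdf
  into the indicator of a bounded interval, and the substitution \<open>s = y + u\<close> moves the
  convolution from the cdf to \<open>M\<close>.\<close>

lemma cdf_fejer_diff:
  assumes "T > 0" "x1 \<le> x2"
  shows "(LBINT u. cdf M (x2 - u) * (T * fejer_density (T * u)))
       - (LBINT u. cdf M (x1 - u) * (T * fejer_density (T * u)))
       = (LBINT s. indicator {x1<..x2} s * (LINT y|M. of_real (T * fejer_density (T * (s - y)))) :: complex)"
proof -
  let ?r = "\<lambda>u. complex_of_real (T * fejer_density (T * u))"
  have r: "integrable lborel ?r"
    using lborel_integrable_real_affine[OF integrable_fejer_density, of T 0] assms by auto
  have k[measurable]: "(\<lambda>(u, y). indicator {x1<..x2} (y + u) :: complex) \<in> borel_measurable (lborel \<Otimes>\<^sub>M M)"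
    by (simp add: measurable_cong_sets[OF sets_pair_measure_cong[OF sets_lborel M_is_borel] refl])
  have k2: "(\<lambda>(s, y). ?r (s - y)) \<in> borel_measurable (lborel \<Otimes>\<^sub>M M)"
    by (simp add: measurable_cong_sets[OF sets_pair_measure_cong[OF sets_lborel M_is_borel] refl])
  have cdf: "of_real (cdf M (x2 - u) - cdf M (x1 - u)) = (LINT y|M. 1 * indicator {x1<..x2} (y + u) :: complex)" for u
  proof -
    have "(\<lambda>y. indicator {x1<..x2} (y + u) :: complex) = (\<lambda>y. of_real (indicator {x1 - u<..x2 - u} y))"
      by (auto simp: fun_eq_iff split: split_indicator)
    moreover have "cdf M (x2 - u) - cdf M (x1 - u) = measure M {x1 - u<..x2 - u}"
      using assms(2) by (cases "x1 = x2") (auto intro!: cdf_diff_eq)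
    ultimately show ?thesis by (simp add: borel_UNIV integral_complex_of_real del: of_real_indicator)
  qed
  have "complex_of_real ((LBINT u. cdf M (x2 - u) * (T * fejer_density (T * u)))
       - (LBINT u. cdf M (x1 - u) * (T * fejer_density (T * u))))
     = of_real (LBINT u. (T * fejer_density (T * u)) * (cdf M (x2 - u) - cdf M (x1 - u)))"
    using integrable_cdf_fejer[OF assms(1)]
    by (subst Bochner_Integration.integral_diff[symmetric]) (auto simp: algebra_simps)
  also have "\<dots> = (LBINT u. ?r u * (LINT y|M. 1 * indicator {x1<..x2} (y + u)))"
    unfolding cdf[symmetric] by (simp flip: integral_complex_of_real)
  also have "\<dots> = (LINT y|M. 1 * (LBINT u. ?r u * indicator {x1<..x2} (y + u)))"
    using r k by (intro lebesgue_Fubini_bounded[where C = 1])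
      (auto simp: sigma_finite lborel.sigma_finite_measure_axioms indicator_def)
  also have "\<dots> = (LINT y|M. 1 * (LBINT s. indicator {x1<..x2} s * ?r (s - y)))"
  proof -
    have "(LBINT u. ?r u * indicator {x1<..x2} (y + u)) = (LBINT s. indicator {x1<..x2} s * ?r (s - y))" for y
      by (subst (2) lborel_integral_real_affine[where c = 1 and t = y]) (auto simp: mult_ac)
    then show ?thesis by simp
  qed
  \<comment> \<open>Now the indicator is the integrable factor and the kernel the bounded one, with
    bound \<open>T\<close> because the density is at most \<open>1\<close>.\<close>
  also have "\<dots> = (LBINT s. indicator {x1<..x2} s * (LINT y|M. 1 * ?r (s - y)))"
    using k2 assms(1) integrable_indicator_Ioc
    by (intro lebesgue_Fubini_bounded[where C = T, symmetric])
       (auto simp: sigma_finite lborel.sigma_finite_measure_axioms fejer_density_nonneg norm_mult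
             intro!: mult_left_le fejer_density_le)
  finally show ?thesis by simp
qed

end

section \<open>Fourier integrals of multiples of the tent\<close>

lemma integrable_tent_mult:
  fixes w :: "real \<Rightarrow> complex"
  assumes "T > 0" "continuous_on UNIV w"
  shows "integrable lborel (\<lambda>t. of_real (tent T t) * w t)"
proof (rule Bochner_Integration.integrable_bound)
  show "integrable lborel (\<lambda>t. indicator {-T..T} t *\<^sub>R w t)"
    using borel_integrable_atLeastAtMost'[OF continuous_on_subset[OF assms(2)]] 
    by (simp add: set_integrable_def)
  have [measurable]: "w \<in> borel_measurable borel"
    using assms(2) by (rule borel_measurable_continuous_onI)
  show "(\<lambda>t. of_real (tent T t) * w t) \<in> borel_measurable lborel" by measurable
  show "AE t in lborel. norm (of_real (tent T t) * w t) \<le> norm (indicator {-T..T} t *\<^sub>R w t)"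
    using tent_bounds[OF assms(1)] by (auto simp: norm_mult intro!: AE_I2 mult_right_mono)
qed

text \<open>Averaging the integral \<open>J x\<close> with its half-period shift bounds it by half
  the L1 distance between \<open>k\<close> and its translate by \<open>pi / x\<close>. This tends to
  \<open>0\<close> since \<open>k\<close> is continuous with compact support. The result anchors the
  inversion integral at the left end of the line.\<close>

lemma Riemann_Lebesgue_tent:
  fixes w :: "real \<Rightarrow> complex"
  assumes "T > 0" and w: "continuous_on UNIV w"
  shows "(\<lambda>n. LBINT t. of_real (tent T t) * w t * exp (\<i> * of_real t * of_real (- real n))) \<longlonglongrightarrow> 0"
proof -
  define k where "k t = of_real (tent T t) * w t" for t
  define J where "J x = (LBINT t. k t * exp (\<i> * of_real t * of_real x))" for x
  have contk: "continuous_on UNIV k"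
    unfolding k_def tent_def using assms(1) by (intro continuous_intros w) auto
  then have [measurable]: "k \<in> borel_measurable borel" by (rule borel_measurable_continuous_onI)
  have k0: "k t = 0" if "t \<notin> {-T..T}" for t
    using that assms(1) by (auto simp: k_def tent_def max_def field_simps)
  have intk: "integrable lborel k"
    unfolding k_def by (rule integrable_tent_mult[OF assms])
  have inte: "integrable lborel (\<lambda>t. k t * exp (\<i> * of_real t * of_real x))" for x
    by (rule Bochner_Integration.integrable_bound[OF intk]) (auto simp: norm_mult)
  have "bounded (k ` {-T..T})"
    by (intro compact_imp_bounded compact_continuous_image continuous_on_subset[OF contk]) auto
  then obtain B where B: "\<And>t. t \<in> {-T..T} \<Longrightarrow> cmod (k t) \<le> B" "B > 0"
    unfolding bounded_pos by blast
  have Bk: "cmod (k t) \<le> B" for t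
    using B k0[of t] by (cases "t \<in> {-T..T}") auto
  \<comment> \<open>Shifting \<open>t\<close> by \<open>pi / x\<close> changes the sign of the exponential.\<close>
  have bound: "cmod (J x) \<le> (LBINT t. cmod (k t - k (t + pi / x))) / 2" if "x \<noteq> 0" for x
  proof -
    have "J x = (LBINT t. k (pi / x + 1 * t) * exp (\<i> * of_real (pi / x + 1 * t) * of_real x))"
      unfolding J_def by (subst lborel_integral_real_affine[of 1 _ "pi / x"]) auto
    also have "\<dots> = (LBINT t. - (k (t + pi / x) * exp (\<i> * of_real t * of_real x)))"
    proof (rule Bochner_Integration.integral_cong[OF refl])
      fix t
      have "\<i> * of_real (pi / x + 1 * t) * of_real x = \<i> * of_real t * of_real x + \<i> * of_real pi"
        using that by (simp add: field_simps)
      then show "k (pi / x + 1 * t) * exp (\<i> * of_real (pi / x + 1 * t) * of_real x)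
          = - (k (t + pi / x) * exp (\<i> * of_real t * of_real x))"
        by (simp add: exp_add add.commute)
    qed
    finally have J2: "J x = (LBINT t. - (k (t + pi / x) * exp (\<i> * of_real t * of_real x)))" .
    have ints: "integrable lborel (\<lambda>t. k (t + pi / x) * exp (\<i> * of_real t * of_real x))"
    proof (rule Bochner_Integration.integrable_bound)
      show "integrable lborel (\<lambda>t. k (pi / x + 1 * t))"
        by (rule lborel_integrable_real_affine[OF intk]) simp
    qed (auto simp: norm_mult add.commute)
    have "2 * J x = (LBINT t. k t * exp (\<i> * of_real t * of_real x)) + (LBINT t. - (k (t + pi / x) * exp (\<i> * of_real t * of_real x)))"
      using J2 J_def by simp
    also have "\<dots> = (LBINT t. (k t - k (t + pi / x)) * exp (\<i> * of_real t * of_real x))"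
      using Bochner_Integration.integral_diff[OF inte ints] by (simp add: left_diff_distrib)
    finally have "cmod (2 * J x) \<le> (LBINT t. cmod ((k t - k (t + pi / x)) * exp (\<i> * of_real t * of_real x)))"
      by (simp only: integral_norm_bound)
    then show ?thesis by (simp add: norm_mult)
  qed
  have "(\<lambda>n. LBINT t. cmod (k t - k (t + pi / - real n))) \<longlonglongrightarrow> (LBINT t::real. 0)"
  proof (rule integral_dominated_convergence)
    \<comment> \<open>The translation is by at most \<open>pi < 4\<close>, so \<open>k\<close> and
      its translate both vanish outside this enlarged interval.\<close>
    show "integrable lborel (\<lambda>t. indicator {-T-4..T+4} t * (2 * B))"
      by (intro integrable_mult_left integrable_real_indicator) (auto simp: emeasure_lborel_Icc_eq)
    have "(\<lambda>n. pi / - real n) \<longlonglongrightarrow> 0" by real_asymp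
    then have "(\<lambda>n. t + pi / - real n) \<longlonglongrightarrow> t" for t
      by (auto intro: tendsto_eq_intros)
    then have "(\<lambda>n. k (t + pi / - real n)) \<longlonglongrightarrow> k t" for t
      by (rule isCont_tendsto_compose[rotated]) (use contk in \<open>simp add: continuous_on_eq_continuous_at\<close>)
    then have "(\<lambda>n. cmod (k t - k (t + pi / - real n))) \<longlonglongrightarrow> cmod (k t - k t)" for t
      by (intro tendsto_intros)
    then show "AE t in lborel. (\<lambda>n. cmod (k t - k (t + pi / - real n))) \<longlonglongrightarrow> 0"
      by simp
    fix n
    have "cmod (k t - k (t + pi / - real n)) \<le> indicator {-T-4..T+4} t * (2 * B)" for t
    proof (cases "t \<in> {-T-4..T+4}")
      case True
      then show ?thesis
        using norm_triangle_ineq4[of "k t" "k (t + pi / - real n)"] Bk[of t] Bk[of "t + pi / - real n"] by simp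
    next
      case False
      \<comment> \<open>At \<open>n = 0\<close> division by zero makes the shift \<open>0\<close>,
        so the bounds on \<open>c\<close> hold there too.\<close>
      define c where "c = pi / real n"
      have "0 \<le> c" "c \<le> 4"
        unfolding c_def using pi_less_4 by (cases n; simp add: field_simps; fail)+
      with False have "t \<notin> {-T..T}" "t - c \<notin> {-T..T}" by auto
      then have "t \<notin> {-T..T}" "t + pi / - real n \<notin> {-T..T}" by (auto simp: c_def)
      then show ?thesis using B(2) by (simp add: k0 zero_le_mult_iff del: atLeastAtMost_iff)
    qed
    then show "AE t in lborel. norm (cmod (k t - k (t + pi / - real n))) \<le> indicator {-T-4..T+4} t * (2 * B)"
      by simp
  qed simp_all
  then have "(\<lambda>n. (LBINT t. cmod (k t - k (t + pi / - real n))) / 2) \<longlonglongrightarrow> 0"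
    by (auto intro: tendsto_eq_intros)
  moreover have "\<forall>\<^sub>F n in sequentially. norm (J (- real n)) \<le> (LBINT t. cmod (k t - k (t + pi / - real n))) / 2"
    using eventually_gt_at_top[of 0]
  proof eventually_elim
    fix n :: nat assume "0 < n"
    then show "norm (J (- real n)) \<le> (LBINT t. cmod (k t - k (t + pi / - real n))) / 2"
      by (intro bound) simp
  qed
  ultimately have "(\<lambda>n. J (- real n)) \<longlonglongrightarrow> 0" by (rule Lim_null_comparison[rotated])
  then show ?thesis unfolding J_def k_def .
qed

text \<open>For \<open>x1 \<le> x2\<close> and nonzero \<open>t\<close> this is the difference of
  \<open>exp (\<i> * t * x2)\<close> and \<open>exp (\<i> * t * x1)\<close> divided by
  \<open>\<i> * t\<close>. The integral form has the right value at \<open>t = 0\<close> and is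
  visibly bounded in \<open>t\<close>.\<close>

definition oscillation :: "real \<Rightarrow> real \<Rightarrow> real \<Rightarrow> complex" where
  "oscillation x1 x2 t = (LBINT s. indicator {x1<..x2} s * exp (\<i> * of_real t * of_real s))"

lemma oscillation_kernel_measurable:
  "(\<lambda>(s, t). exp (\<i> * of_real t * of_real s)) \<in> borel_measurable (borel \<Otimes>\<^sub>M borel)"
  "(\<lambda>(t, s). exp (\<i> * of_real t * of_real s)) \<in> borel_measurable (borel \<Otimes>\<^sub>M borel)"
  by (intro borel_measurable_continuous_onI continuous_intros | simp add: split_def borel_prod)+

lemma oscillation_measurable [measurable]: "oscillation x1 x2 \<in> borel_measurable borel"
proof -
  note oscillation_kernel_measurable(2)[measurable]
  show ?thesis unfolding oscillation_def by measurable
qed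

lemma oscillation_mult:
  assumes "x1 \<le> x2"
  shows "\<i> * of_real t * oscillation x1 x2 t
    = exp (\<i> * of_real t * of_real x2) - exp (\<i> * of_real t * of_real x1)"
proof -
  define E where "E s = exp (\<i> * of_real t * of_real s)" for s :: real
  have "(LBINT s. indicator {x1..x2} s *\<^sub>R (\<i> * of_real t * exp (\<i> * of_real t * of_real s))) = E x2 - E x1"
  proof (rule integral_FTC_Icc[OF assms])
    fix s
    have "((\<lambda>z. exp (\<i> * of_real t * z)) has_field_derivative \<i> * of_real t * exp (\<i> * of_real t * of_real s)) (at (of_real s))"
      by (auto intro!: derivative_eq_intros)
    from has_vector_derivative_real_field[OF this]
    show "(E has_vector_derivative \<i> * of_real t * exp (\<i> * of_real t * of_real s)) (at s within {x1..x2})"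
      unfolding E_def by (rule has_vector_derivative_at_within)
  qed (auto intro!: continuous_intros)
  moreover have "(LBINT s. indicator {x1..x2} s *\<^sub>R (\<i> * of_real t * exp (\<i> * of_real t * of_real s)))
      = (LBINT s. \<i> * of_real t * (indicator {x1<..x2} s * exp (\<i> * of_real t * of_real s)))"
  proof (rule integral_cong_AE)
    show "AE s in lborel. indicator {x1..x2} s *\<^sub>R (\<i> * of_real t * exp (\<i> * of_real t * of_real s))
      = \<i> * of_real t * (indicator {x1<..x2} s * exp (\<i> * of_real t * of_real s))"
      using AE_lborel_singleton[of x1] by eventually_elim (auto split: split_indicator)
  qed measurable
  ultimately show ?thesis by (simp add: E_def oscillation_def)
qed

lemma norm_oscillation_le: "cmod (oscillation x1 x2 t) \<le> (LBINT s. cmod (indicator {x1<..x2} s))"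
proof -
  have "cmod (oscillation x1 x2 t) \<le> (LBINT s. cmod (indicator {x1<..x2} s * exp (\<i> * of_real t * of_real s)))"
    unfolding oscillation_def by (rule integral_norm_bound)
  then show ?thesis by (simp add: norm_mult)
qed

context finite_borel_measure
begin

lemma integrable_tent_fourier:
  assumes "T > 0"
  shows "integrable lborel (\<lambda>t. of_real (tent T t) * fourier M t)"
  by (rule integrable_tent_mult[OF assms])
     (simp add: continuous_on_eq_continuous_at isCont_fourier)

lemma integrable_tent_fourier_oscillation:
  assumes "T > 0"
  shows "integrable lborel (\<lambda>t. of_real (tent T t) * fourier M t * oscillation x1 x2 t)"
proof (rule Bochner_Integration.integrable_bound)
  have [measurable]: "fourier M \<in> borel_measurable borel"
    by (rule borel_measurable_continuous_onI) (simp add: continuous_on_eq_continuous_at isCont_fourier)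
  show "(\<lambda>t. of_real (tent T t) * fourier M t * oscillation x1 x2 t) \<in> borel_measurable lborel"
    by measurable
  show "integrable lborel (\<lambda>t. (LBINT s. cmod (indicator {x1<..x2} s)) * norm (of_real (tent T t) * fourier M t))"
    using integrable_tent_fourier[OF assms] by (intro integrable_mult_right integrable_norm)
  show "AE t in lborel. norm (of_real (tent T t) * fourier M t * oscillation x1 x2 t)
      \<le> norm ((LBINT s. cmod (indicator {x1<..x2} s)) * norm (of_real (tent T t) * fourier M t))"
  proof (rule AE_I2)
    fix t
    have "norm (of_real (tent T t) * fourier M t * oscillation x1 x2 t)
        \<le> norm (of_real (tent T t) * fourier M t) * \<bar>LBINT s. cmod (indicator {x1<..x2} s)\<bar>"
      unfolding norm_mult[of _ "oscillation x1 x2 t"]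
      using norm_oscillation_le[of x1 x2 t] by (intro mult_left_mono) auto
    then show "norm (of_real (tent T t) * fourier M t * oscillation x1 x2 t)
        \<le> norm ((LBINT s. cmod (indicator {x1<..x2} s)) * norm (of_real (tent T t) * fourier M t))"
      by (simp only: norm_mult real_norm_def abs_mult abs_norm_cancel abs_abs mult.commute)
  qed
qed

text \<open>Integrating over \<open>s\<close> first puts the dependence on the interval into
  \<open>oscillation\<close> and that on the measure into \<open>fourier M\<close>, so signed
  combinations of measures can be added up linearly.\<close>

lemma cdf_fejer_diff_fourier:
  assumes "T > 0" "x1 \<le> x2"
  shows "of_real ((LBINT u. cdf M (x2 - u) * (T * fejer_density (T * u)))
       - (LBINT u. cdf M (x1 - u) * (T * fejer_density (T * u))))
       = (LBINT t. of_real (tent T t) * fourier M t * oscillation x1 x2 t) / of_real (2 * pi)"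
proof -
  have "of_real ((LBINT u. cdf M (x2 - u) * (T * fejer_density (T * u)))
       - (LBINT u. cdf M (x1 - u) * (T * fejer_density (T * u))))
    = (LBINT s. indicator {x1<..x2} s *
       ((LBINT t. (of_real (tent T t) * fourier M t) * exp (\<i> * of_real t * of_real s)) / of_real (2 * pi)))"
    unfolding cdf_fejer_diff[OF assms] fejer_fourier[OF assms(1)] by (simp add: mult_ac)
  also have "\<dots> = (LBINT s. indicator {x1<..x2} s *
       (LBINT t. (of_real (tent T t) * fourier M t) * exp (\<i> * of_real t * of_real s))) / of_real (2 * pi)"
    by (simp only: times_divide_eq_right integral_divide_zero)
  also have "(LBINT s. indicator {x1<..x2} s *
       (LBINT t. (of_real (tent T t) * fourier M t) * exp (\<i> * of_real t * of_real s)))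
    = (LBINT t. (of_real (tent T t) * fourier M t) * (LBINT s. indicator {x1<..x2} s * exp (\<i> * of_real t * of_real s)))"
  proof (rule lebesgue_Fubini_bounded[where C = 1])
    show "(\<lambda>(s, t). exp (\<i> * of_real t * of_real s)) \<in> borel_measurable (lborel \<Otimes>\<^sub>M lborel)"
      using oscillation_kernel_measurable(1)
      by (simp add: measurable_cong_sets[OF sets_pair_measure_cong[OF sets_lborel sets_lborel] refl])
  qed (use integrable_tent_fourier[OF assms(1)] integrable_indicator_Ioc in
        \<open>auto simp: lborel.sigma_finite_measure_axioms\<close>)
  finally show ?thesis by (simp add: oscillation_def)
qed

lemma cdf_fejer_at_bot:
  assumes "T > 0"
  shows "(\<lambda>n. LBINT u. cdf M (- real n - u) * (T * fejer_density (T * u))) \<longlonglongrightarrow> 0"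
proof -
  have "(\<lambda>n. LBINT u. cdf M (- real n - u) * (T * fejer_density (T * u))) \<longlonglongrightarrow> (LBINT u::real. 0)"
  proof (rule integral_dominated_convergence)
    show "integrable lborel (\<lambda>u. (measure M UNIV * T) * fejer_density (T * u))"
      using lborel_integrable_real_affine[OF integrable_fejer_density, of T 0] assms
      by (intro integrable_mult_right) auto
    have "(\<lambda>n. cdf M (- real n - u)) \<longlonglongrightarrow> 0" for u
      by (rule filterlim_compose[OF cdf_lim_at_bot]) real_asymp
    from tendsto_mult_left_zero[OF this]
    show "AE u in lborel. (\<lambda>n. cdf M (- real n - u) * (T * fejer_density (T * u))) \<longlonglongrightarrow> 0"
      by simp
    show "AE u in lborel. norm (cdf M (- real n - u) * (T * fejer_density (T * u)))
      \<le> measure M UNIV * T * fejer_density (T * u)" for n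
      using assms abs_cdf_le fejer_density_nonneg
      by (auto simp: abs_mult intro!: AE_I2 mult_right_mono)
  qed measurable
  then show ?thesis by simp
qed

end

text \<open>
  The difference of the distribution functions need not be integrable, so it has no Fourier
  transform to invert. Instead, both sides have the same increments in \<open>x\<close> and tend to
  \<open>0\<close> as \<open>x\<close> tends to \<open>-\<infinity>\<close>.
\<close>

lemma fejer_smoothing_identity:
  assumes "T > 0"
    and P1: "finite_borel_measure P1" and N1: "finite_borel_measure N1"
    and P2: "finite_borel_measure P2" and N2: "finite_borel_measure N2"
    and w: "continuous_on UNIV w"
      "\<And>t. of_real t * w t = (fourier P1 t - fourier N1 t) - (fourier P2 t - fourier N2 t)"
  shows "of_real (LBINT u. ((cdf P1 (x - u) - cdf N1 (x - u)) - (cdf P2 (x - u) - cdf N2 (x - u)))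
      * (T * fejer_density (T * u)))
    = (LBINT t. of_real (tent T t) * w t * exp (\<i> * of_real t * of_real x)) / (2 * pi * \<i>)"
proof -
  define g where "g P x = (LBINT u. cdf P (x - u) * (T * fejer_density (T * u)))" for P x
  define G where "G x = (g P1 x - g N1 x) - (g P2 x - g N2 x)" for x
  define J where "J x = (LBINT t. of_real (tent T t) * w t * exp (\<i> * of_real t * of_real x)) / (2 * pi * \<i>)" for x
  define Q where "Q P x1 x2 t = of_real (tent T t) * fourier P t * oscillation x1 x2 t" for P x1 x2 t
  have w_exp: "integrable lborel (\<lambda>t. of_real (tent T t) * (w t * exp (\<i> * of_real t * of_real x)))" for x
    by (intro integrable_tent_mult assms(1) continuous_intros w)
  note fourier_lemmas = P1 N1 P2 N2
  note intc = fourier_lemmas[THEN finite_borel_measure.integrable_cdf_fejer, OF assms(1)]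
  note intQ = fourier_lemmas[THEN finite_borel_measure.integrable_tent_fourier_oscillation, OF assms(1), folded Q_def]
  have G: "(LBINT u. ((cdf P1 (x - u) - cdf N1 (x - u)) - (cdf P2 (x - u) - cdf N2 (x - u)))
      * (T * fejer_density (T * u))) = G x" for x
    unfolding left_diff_distrib G_def g_def by (simp add: intc)
  have diff: "of_real (G x2 - G x1) = J x2 - J x1" if "x1 \<le> x2" for x1 x2
  proof -
    note d = fourier_lemmas[THEN finite_borel_measure.cdf_fejer_diff_fourier, OF assms(1) that, folded g_def Q_def]
    have "complex_of_real (G x2 - G x1)
      = (of_real (g P1 x2 - g P1 x1) - of_real (g N1 x2 - g N1 x1))
       - (of_real (g P2 x2 - g P2 x1) - of_real (g N2 x2 - g N2 x1))"
      by (simp add: G_def)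
    also have "\<dots> = (LBINT t. (Q P1 x1 x2 t - Q N1 x1 x2 t) - (Q P2 x1 x2 t - Q N2 x1 x2 t)) / of_real (2 * pi)"
      unfolding d by (simp add: intQ diff_divide_distrib)
    also have "(\<lambda>t. (Q P1 x1 x2 t - Q N1 x1 x2 t) - (Q P2 x1 x2 t - Q N2 x1 x2 t))
      = (\<lambda>t. (of_real (tent T t) * (w t * exp (\<i> * of_real t * of_real x2))
            - of_real (tent T t) * (w t * exp (\<i> * of_real t * of_real x1))) / \<i>)"
    proof
      fix t
      have "(Q P1 x1 x2 t - Q N1 x1 x2 t) - (Q P2 x1 x2 t - Q N2 x1 x2 t)
        = of_real (tent T t) * ((fourier P1 t - fourier N1 t) - (fourier P2 t - fourier N2 t)) * oscillation x1 x2 t"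
        by (simp add: Q_def algebra_simps)
      \<comment> \<open>The factor \<open>t\<close> supplied by the hypothesis on \<open>w\<close>
        cancels the denominator hidden in \<open>oscillation\<close> and leaves a difference of
        exponentials.\<close>
      also have "\<dots> = of_real (tent T t) * w t * (\<i> * of_real t * oscillation x1 x2 t) / \<i>"
        by (simp only: w(2)[symmetric] nonzero_eq_divide_eq[OF complex_i_not_zero] mult_ac)
      finally show "(Q P1 x1 x2 t - Q N1 x1 x2 t) - (Q P2 x1 x2 t - Q N2 x1 x2 t)
        = (of_real (tent T t) * (w t * exp (\<i> * of_real t * of_real x2))
            - of_real (tent T t) * (w t * exp (\<i> * of_real t * of_real x1))) / \<i>"
        unfolding oscillation_mult[OF that] by (simp add: right_diff_distrib mult.assoc)
    qed
    also have "(LBINT t. (of_real (tent T t) * (w t * exp (\<i> * of_real t * of_real x2))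
            - of_real (tent T t) * (w t * exp (\<i> * of_real t * of_real x1))) / \<i>) / of_real (2 * pi) = J x2 - J x1"
      unfolding integral_divide_zero Bochner_Integration.integral_diff[OF w_exp w_exp] J_def
      by (simp add: mult_ac diff_divide_distrib del: divide_i)
    finally show ?thesis .
  qed
  \<comment> \<open>The increment identity is applied from \<open>-n\<close> to \<open>x\<close>. As
    \<open>n\<close> grows, the contributions of the left end vanish by
    \<open>cdf_fejer_at_bot\<close> and \<open>Riemann_Lebesgue_tent\<close>.\<close>
  have "(\<lambda>n. complex_of_real (G x - G (- real n))) \<longlonglongrightarrow> of_real (G x - ((0 - 0) - (0 - 0)))"
    unfolding G_def g_def
    by (intro tendsto_intros fourier_lemmas[THEN finite_borel_measure.cdf_fejer_at_bot] assms(1))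
  moreover have "(\<lambda>n. J x - J (- real n)) \<longlonglongrightarrow> J x - 0 / (2 * pi * \<i>)"
    unfolding J_def by (intro tendsto_intros Riemann_Lebesgue_tent assms(1) w) auto
  moreover have "\<forall>\<^sub>F n in sequentially. J x - J (- real n) = complex_of_real (G x - G (- real n))"
    using eventually_ge_at_top[of "nat \<lceil>- x\<rceil>"]
  proof eventually_elim
    fix n assume "nat \<lceil>- x\<rceil> \<le> n"
    then have "- real n \<le> x" by linarith
    from diff[OF this] show "J x - J (- real n) = complex_of_real (G x - G (- real n))" by simp
  qed
  ultimately have "of_real (G x) = J x"
    using LIMSEQ_unique[OF Lim_transform_eventually] by fastforce
  then show ?thesis by (simp only: G J_def)
qed

subsection \<open>The smoothing inequality\<close>

text \<open>At worst \<open>D\<close> is \<open>c\<close> on the window of mass \<open>3/4\<close>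
  and \<open>-\<delta>\<close> on the remaining mass \<open>1/4\<close>.\<close>

lemma fejer_window_lower_bound:
  fixes D :: "real \<Rightarrow> real"
  assumes T: "T > 0" and a: "(LBINT u:{-a<..<a}. T * fejer_density (T * u)) = 3 / 4"
    and [measurable]: "D \<in> borel_measurable borel"
    and D: "\<And>u. \<bar>D u\<bar> \<le> \<delta>" "\<And>u. \<bar>u\<bar> < a \<Longrightarrow> c \<le> D u"
  shows "3 / 4 * (c + \<delta>) - \<delta> \<le> (LBINT u. D u * (T * fejer_density (T * u)))"
proof -
  let ?r = "\<lambda>u. T * fejer_density (T * u)"
  have r: "integrable lborel ?r"
    using lborel_integrable_real_affine[OF integrable_fejer_density, of T 0] T by auto
  have r1: "(LBINT u. ?r u) = 1"
    using lborel_integral_real_affine[of T fejer_density 0] T integral_fejer_density by simp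
  have r0: "0 \<le> ?r u" for u using T fejer_density_nonneg by simp
  have \<delta>: "0 \<le> \<delta>" using D(1)[of 0] by simp
  have ind: "integrable lborel (\<lambda>u. indicator {-a<..<a} u * ?r u)"
    by (rule Bochner_Integration.integrable_bound[OF r]) (auto simp: indicator_def)
  have "3 / 4 * (c + \<delta>) - \<delta> = (LBINT u. (c + \<delta>) * (indicator {-a<..<a} u * ?r u) - \<delta> * ?r u)"
    using a
    by (simp only: Bochner_Integration.integral_diff[OF integrable_mult_right[OF ind] integrable_mult_right[OF r]]
      integral_mult_right_zero r1[unfolded integral_mult_right_zero] set_lebesgue_integral_def
      real_scaleR_def)
  also have "\<dots> \<le> (LBINT u. D u * ?r u)"
  proof (rule integral_mono)
    show "integrable lborel (\<lambda>u. (c + \<delta>) * (indicator {-a<..<a} u * ?r u) - \<delta> * ?r u)"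
      using ind r by auto
    show "integrable lborel (\<lambda>u. D u * ?r u)"
    proof (rule Bochner_Integration.integrable_bound)
      show "integrable lborel (\<lambda>u. \<delta> * ?r u)" using r by auto
      show "AE u in lborel. norm (D u * ?r u) \<le> norm (\<delta> * ?r u)"
        using D(1) \<delta> r0 by (auto simp: abs_mult intro!: mult_right_mono)
    qed measurable
    fix u
    have "c * indicator {-a<..<a} u + \<delta> * indicator {-a<..<a} u - \<delta> \<le> D u"
      using D(1)[of u] D(2)[of u] by (auto split: split_indicator simp: abs_le_iff)
    from mult_right_mono[OF this r0[of u]]
    show "(c + \<delta>) * (indicator {-a<..<a} u * ?r u) - \<delta> * ?r u \<le> D u * ?r u"
      by (simp only: algebra_simps)
  qed
  finally show ?thesis .
qed

text \<open>The convolution sees \<open>F - H\<close> only through its right limits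
  \<open>D\<close>. With \<open>a = b / T\<close>, the window estimate gives
  \<open>|F y - H y| \<le> 4/3 K + 2 a L + \<delta>/3\<close>; taking the supremum and moving
  \<open>\<delta>/3\<close> to the left yields \<open>\<delta> \<le> 2 K + 3 a L\<close>.\<close>

lemma fejer_smoothing_inequality:
  fixes F H D :: "real \<Rightarrow> real"
  assumes F: "mono F" and H: "\<And>x y. \<bar>H x - H y\<bar> \<le> L * \<bar>x - y\<bar>"
    and [measurable]: "D \<in> borel_measurable borel"
    and D: "\<And>x. ((\<lambda>z. F z - H z) \<longlongrightarrow> D x) (at_right x)"
    and \<delta>: "\<And>y. \<bar>F y - H y\<bar> \<le> \<delta>" "\<And>\<epsilon>. (\<And>y. \<bar>F y - H y\<bar> \<le> \<epsilon>) \<Longrightarrow> \<delta> \<le> \<epsilon>"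
    and T: "T > 0" and b: "b > 0" "(LBINT y:{-b..b}. fejer_density y) = 3 / 4"
    and K: "\<And>x. \<bar>LBINT u. D (x - u) * (T * fejer_density (T * u))\<bar> \<le> K"
  shows "\<delta> \<le> 2 * K + 3 * b / T * L"
proof -
  define a where "a = b / T"
  have a0: "a > 0" using T b by (simp add: a_def)
  have L: "0 \<le> L" using H[of 1 0] by simp
  have "(LBINT y:{-b..b}. fejer_density y) = (LBINT u. T * (indicator {-b..b} (T * u) * fejer_density (T * u)))"
    using lborel_integral_real_affine[of T "\<lambda>y. indicator {-b..b} y * fejer_density y" 0] T
    by (simp add: set_lebesgue_integral_def)
  \<comment> \<open>The endpoints are a null set. The open window keeps \<open>y - a - u < y\<close>
    strict, as \<open>Dup\<close> requires.\<close>
  also have "\<dots> = (LBINT u:{-a<..<a}. T * fejer_density (T * u))"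
    unfolding set_lebesgue_integral_def
  proof (rule integral_cong_AE)
    show "AE u in lborel. T * (indicator {-b..b} (T * u) * fejer_density (T * u))
        = indicator {-a<..<a} u *\<^sub>R (T * fejer_density (T * u))"
      using AE_lborel_singleton[of a] AE_lborel_singleton[of "- a"]
    proof eventually_elim
      fix u assume "u \<noteq> a" "u \<noteq> - a"
      then show "T * (indicator {-b..b} (T * u) * fejer_density (T * u))
        = indicator {-a<..<a} u *\<^sub>R (T * fejer_density (T * u))"
        using T unfolding a_def by (auto simp: field_simps split: split_indicator)
    qed
  qed measurable
  finally have a: "(LBINT u:{-a<..<a}. T * fejer_density (T * u)) = 3 / 4" using b(2) by simp
  have DB: "\<bar>D x\<bar> \<le> \<delta>" for x
    by (rule tendsto_upperbound[OF tendsto_rabs[OF D[of x]]]) (simp_all add: \<delta>)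
  have Dlow: "F y - H y - L * (x - y) \<le> D x" if "y \<le> x" for x y
  proof (rule tendsto_le[OF _ D])
    show "((\<lambda>z. F y - H y - L * (z - y)) \<longlongrightarrow> F y - H y - L * (x - y)) (at_right x)"
      by (intro tendsto_intros)
    show "\<forall>\<^sub>F z in at_right x. F y - H y - L * (z - y) \<le> F z - H z"
      using eventually_at_right_less[of x]
    proof eventually_elim
      fix z assume "x < z"
      then show "F y - H y - L * (z - y) \<le> F z - H z"
        using that monoD[OF F, of y z] H[of z y] by (auto simp: abs_le_iff)
    qed
  qed simp
  have Dup: "D x \<le> F y - H y + L * (y - x)" if "x < y" for x y
  proof (rule tendsto_le[OF _ _ D])
    show "((\<lambda>z. F y - H y + L * (y - z)) \<longlongrightarrow> F y - H y + L * (y - x)) (at_right x)"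
      by (intro tendsto_intros)
    show "\<forall>\<^sub>F z in at_right x. F z - H z \<le> F y - H y + L * (y - z)"
      using eventually_at_right_real[OF that]
    proof eventually_elim
      fix z assume "z \<in> {x<..<y}"
      then show "F z - H z \<le> F y - H y + L * (y - z)"
        using monoD[OF F, of z y] H[of y z] by (auto simp: abs_le_iff)
    qed
  qed simp
  have "3 / 4 * (\<bar>F y - H y\<bar> - 2 * a * L + \<delta>) - \<delta> \<le> K" for y
  proof (cases "0 \<le> F y - H y")
    case True
    \<comment> \<open>Centring at \<open>y + a\<close> makes the window cover points to the right of
      \<open>y\<close>, where the difference can fall at most at rate \<open>L\<close>.\<close>
    have "3 / 4 * (\<bar>F y - H y\<bar> - 2 * a * L + \<delta>) - \<delta> \<le> (LBINT u. D ((y + a) - u) * (T * fejer_density (T * u)))"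
    proof (rule fejer_window_lower_bound[OF T a])
      fix u assume u: "\<bar>u\<bar> < a"
      have "L * (y + a - u - y) \<le> L * (2 * a)" using L u by (intro mult_left_mono) auto
      then show "\<bar>F y - H y\<bar> - 2 * a * L \<le> D (y + a - u)"
        using Dlow[of y "y + a - u"] u True by (simp add: mult.commute mult.left_commute abs_less_iff)
    qed (use DB in auto)
    also have "\<dots> \<le> K" using K[of "y + a"] by simp
    finally show ?thesis .
  next
    case False
    \<comment> \<open>For a negative difference the window lies to the left of \<open>y\<close>, and
      the sign is flipped to get a lower bound.\<close>
    have "3 / 4 * (\<bar>F y - H y\<bar> - 2 * a * L + \<delta>) - \<delta> \<le> (LBINT u. - D ((y - a) - u) * (T * fejer_density (T * u)))"
    proof (rule fejer_window_lower_bound[OF T a])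
      fix u assume u: "\<bar>u\<bar> < a"
      have "L * (y - (y - a - u)) \<le> L * (2 * a)" using L u by (intro mult_left_mono) auto
      then show "\<bar>F y - H y\<bar> - 2 * a * L \<le> - D (y - a - u)"
        using Dup[of "y - a - u" y] u False by (simp add: mult.commute mult.left_commute abs_less_iff)
    qed (use DB in auto)
    also have "\<dots> \<le> K" using K[of "y - a"] by simp
    finally show ?thesis .
  qed
  then have "\<bar>F y - H y\<bar> \<le> 4 / 3 * K + 2 * a * L + \<delta> / 3" for y
    by (simp add: field_simps)
  from \<delta>(2)[OF this] have "\<delta> \<le> 2 * K + 3 * (a * L)" by simp
  then show ?thesis by (simp add: a_def)
qed

subsection \<open>Semicircle integrals\<close>

text \<open>The zero of \<open>g\<close> at the origin makes the singularity of
  \<open>g z / z\<close> removable.\<close>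

lemma holomorphic_quotient_at_0:
  assumes g: "g holomorphic_on S" and "open S" and "g 0 = 0"
  obtains q where "q holomorphic_on S" "\<And>z. z \<in> S \<Longrightarrow> g z = z * q z"
proof
  define q where "q z = (if z = 0 then deriv g 0 else g z / z)" for z
  show "q holomorphic_on S"
    by (rule pole_theorem_open_0[OF g \<open>open S\<close>, where a = 0]) (auto simp: q_def assms(3))
  show "g z = z * q z" if "z \<in> S" for z by (simp add: q_def assms(3))
qed

text \<open>
  By Cauchy's theorem the arcs of radius \<open>s < r\<close> may be replaced by the segment from \<open>-s\<close> to
  \<open>s\<close>, on which the integrand stays continuous up to \<open>\<plusminus>r\<close>; so the limit exists even though
  nothing is known about \<open>G\<close> near the circle.
\<close>

lemma boundary_arc_integral_eq_segment:
  assumes "r > 0" and G: "G holomorphic_on ball 0 r"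
    and gG: "\<And>z. z \<in> ball 0 r \<Longrightarrow> z \<noteq> 0 \<Longrightarrow> g z = G z"
    and k: "continuous_on {-r..r} k" "\<And>t. \<bar>t\<bar> < r \<Longrightarrow> k t = G (of_real t)"
    and b: "exp (\<i> * of_real b) = 1"
  shows "boundary_arc_integral r pi b g = integral {-r..r} k"
proof -
  \<comment> \<open>With a primitive on the disc only the end points of the arc matter. The
    condition on \<open>b\<close> covers both \<open>0\<close> and \<open>2 * pi\<close>, so the two
    semicircles are treated at once.\<close>
  obtain P where P: "\<And>z. z \<in> ball 0 r \<Longrightarrow> (P has_field_derivative G z) (at z within ball 0 r)"
    using holomorphic_convex_primitive'[OF convex_ball open_ball G] by blast
  have arc: "contour_integral (part_circlepath 0 s pi b) g = integral {-r..s} k - integral {-r..-s} k"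
    if s: "0 < s" "s < r" for s
  proof -
    have img: "z \<in> ball 0 r" "z \<noteq> 0" if "z \<in> path_image (part_circlepath 0 s pi b)" for z
      using path_image_part_circlepath_subset'[of s 0 pi b] that s by auto
    have "contour_integral (part_circlepath 0 s pi b) g = contour_integral (part_circlepath 0 s pi b) G"
      using img gG by (intro contour_integral_eq) auto
    also have "\<dots> = P s - P (- s)"
    proof (rule contour_integral_unique)
      have "(G has_contour_integral
        (P (pathfinish (part_circlepath 0 s pi b)) - P (pathstart (part_circlepath 0 s pi b))))
        (part_circlepath 0 s pi b)"
        using img by (intro contour_integral_primitive[OF P]) auto
      then show "(G has_contour_integral (P s - P (- s))) (part_circlepath 0 s pi b)"
        using b by simp
    qed
    also have "\<dots> = integral {-s..s} k"
    proof (rule sym, rule integral_unique)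
      have "((\<lambda>t. P (of_real t)) has_vector_derivative k t) (at t within {-s..s})" if "t \<in> {-s..s}" for t
      proof -
        have "complex_of_real t \<in> ball 0 r" using that s by auto
        then have "(P has_field_derivative k t) (at (of_real t))"
          using P[of "of_real t"] k(2)[of t] that s by (simp add: at_within_open[OF _ open_ball])
        then show ?thesis
          by (rule has_vector_derivative_at_within[OF has_vector_derivative_real_field])
      qed
      then have "(k has_integral (P (of_real s) - P (of_real (- s)))) {-s..s}"
        using s by (intro fundamental_theorem_of_calculus) auto
      then show "(k has_integral (P s - P (- s))) {-s..s}" by simp
    qed
    \<comment> \<open>As a difference of integrals starting at the fixed point \<open>-r\<close>,
      the value is continuous in \<open>s\<close> up to \<open>s = r\<close>.\<close>
    also have "\<dots> = integral {-r..s} k - integral {-r..-s} k"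
      using s by (subst Henstock_Kurzweil_Integration.integral_combine[of "-r" "-s" s k, symmetric])
        (auto intro!: integrable_continuous_interval continuous_on_subset[OF k(1)])
    finally show ?thesis .
  qed
  have cont: "continuous_on {-r..r} (\<lambda>x. integral {-r..x} k)"
    by (intro indefinite_integral_continuous_1 integrable_continuous_interval k)
  have at: "at r within {0..r} = at_left r" using \<open>r > 0\<close> by (rule at_within_Icc_at_left)
  have "continuous_on {0..r} (\<lambda>s. integral {-r..s} k - integral {-r..-s} k)"
    using \<open>r > 0\<close> by (intro continuous_intros continuous_on_compose2[OF cont]) auto
  from bspec[OF this[unfolded continuous_on], of r]
  have "((\<lambda>s. integral {-r..s} k - integral {-r..-s} k) \<longlongrightarrow> integral {-r..r} k - integral {-r..-r} k) (at_left r)"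
    using \<open>r > 0\<close> unfolding at by simp
  moreover have "\<forall>\<^sub>F s in at_left r. integral {-r..s} k - integral {-r..-s} k
      = contour_integral (part_circlepath 0 s pi b) g"
    using eventually_at_left_real[OF \<open>r > 0\<close>] by eventually_elim (simp add: arc)
  ultimately have "((\<lambda>s. contour_integral (part_circlepath 0 s pi b) g)
      \<longlongrightarrow> integral {-r..r} k - integral {-r..-r} k) (at_left r)"
    by (rule Lim_transform_eventually)
  then have "((\<lambda>s. contour_integral (part_circlepath 0 s pi b) g) \<longlongrightarrow> integral {-r..r} k) (at_left r)"
    by simp
  then show ?thesis
    unfolding boundary_arc_integral_def by (intro tendsto_Lim) auto
qed

text \<open>The tent differs from the indicator of \<open>{-r..r}\<close> by \<open>|t| / T\<close>
  inside, by at most \<open>1\<close> for \<open>r < |t| \<le> T\<close>, and not at all beyond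
  \<open>T\<close>. The first two errors give the two extra terms.\<close>

lemma tent_integral_bound:
  fixes w :: "real \<Rightarrow> complex"
  assumes "0 < r" "r \<le> T" and w: "continuous_on UNIV w"
  shows "cmod (LBINT t. of_real (tent T t) * w t * exp (\<i> * of_real t * of_real x))
    \<le> cmod (integral {-r..r} (\<lambda>t. w t * exp (\<i> * of_real t * of_real x)))
      + (LBINT t:{t. r \<le> \<bar>t\<bar> \<and> \<bar>t\<bar> \<le> T}. cmod (w t))
      + 1 / T * (LBINT t:{-T..T}. cmod (of_real t * w t))"
proof -
  let ?e = "\<lambda>t. w t * exp (\<i> * of_real t * of_real x)"
  let ?S = "{t. r \<le> \<bar>t\<bar> \<and> \<bar>t\<bar> \<le> T}"
  let ?R = "\<lambda>t. of_real (tent T t) * ?e t - indicator {-r..r} t *\<^sub>R ?e t"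
  have T: "T > 0" using assms by simp
  have [measurable]: "w \<in> borel_measurable borel" by (rule borel_measurable_continuous_onI[OF w])
  have cont: "continuous_on UNIV ?e" by (intro continuous_intros w)
  have int_tent: "integrable lborel (\<lambda>t. of_real (tent T t) * ?e t)"
    by (rule integrable_tent_mult[OF T cont])
  have set_int: "set_integrable lborel {-r..r} ?e"
    by (rule borel_integrable_atLeastAtMost'[OF continuous_on_subset[OF cont]]) simp
  then have int_ind: "integrable lborel (\<lambda>t. indicator {-r..r} t *\<^sub>R ?e t)"
    by (simp add: set_integrable_def)
  have int_w: "set_integrable lborel {-T..T} (\<lambda>t. cmod (w t))"
    by (rule borel_integrable_atLeastAtMost') (intro continuous_intros continuous_on_subset[OF w], simp)
  have int_S: "integrable lborel (\<lambda>t. indicator ?S t * cmod (w t))"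
    by (rule Bochner_Integration.integrable_bound[OF int_w[unfolded set_integrable_def]])
       (auto split: split_indicator)
  have "set_integrable lborel {-T..T} (\<lambda>t. cmod (of_real t * w t))"
    by (rule borel_integrable_atLeastAtMost') (intro continuous_intros continuous_on_subset[OF w], simp)
  then have int_tw: "integrable lborel (\<lambda>t. indicator {-T..T} t * cmod (of_real t * w t))"
    by (simp add: set_integrable_def)
  have R: "cmod (?R t) \<le> indicator ?S t * cmod (w t) + 1 / T * (indicator {-T..T} t * cmod (of_real t * w t))" for t
  proof -
    have "?R t = of_real (tent T t - indicator {-r..r} t) * ?e t"
      by (simp add: left_diff_distrib split: split_indicator)
    then have eq: "cmod (?R t) = \<bar>tent T t - indicator {-r..r} t\<bar> * cmod (w t)"
      by (simp only: norm_mult norm_of_real) simp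
    consider "\<bar>t\<bar> \<le> r" | "r < \<bar>t\<bar>" "\<bar>t\<bar> \<le> T" | "T < \<bar>t\<bar>" using assms(2) by linarith
    then show ?thesis
    proof cases
      case 1
      then have "cmod (?R t) = 1 / T * (indicator {-T..T} t * cmod (of_real t * w t))"
        unfolding eq using assms by (simp add: tent_def max_def field_simps norm_mult abs_le_iff)
      then show ?thesis by simp
    next
      case 2
      then have "cmod (?R t) = tent T t * cmod (w t)"
        unfolding eq using tent_bounds(1)[OF T, of t] by (auto simp: indicator_def)
      also have "\<dots> \<le> 1 * cmod (w t)"
        by (intro mult_right_mono tent_bounds T) simp
      also have "\<dots> = indicator ?S t * cmod (w t)" using 2 by simp
      finally show ?thesis using T by (simp add: add_increasing2)
    next
      case 3
      then have "t \<notin> {-r..r}" "1 - \<bar>t\<bar> / T \<le> 0"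
        using assms by (auto simp: field_simps)
      then have "cmod (?R t) = 0"
        unfolding eq by (simp add: tent_def)
      then show ?thesis using T by simp
    qed
  qed
  have "(LBINT t. of_real (tent T t) * ?e t) = (LBINT t. indicator {-r..r} t *\<^sub>R ?e t) + (LBINT t. ?R t)"
    using Bochner_Integration.integral_diff[OF int_tent int_ind] by simp
  moreover have "(LBINT t. indicator {-r..r} t *\<^sub>R ?e t) = integral {-r..r} ?e"
    using set_borel_integral_eq_integral(2)[OF set_int] by (simp add: set_lebesgue_integral_def)
  ultimately have "cmod (LBINT t. of_real (tent T t) * ?e t) \<le> cmod (integral {-r..r} ?e) + cmod (LBINT t. ?R t)"
    by (simp only: norm_triangle_ineq)
  also have "cmod (LBINT t. ?R t) \<le> (LBINT t. cmod (?R t))" by (rule integral_norm_bound)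
  also have "\<dots> \<le> (LBINT t. indicator ?S t * cmod (w t) + 1 / T * (indicator {-T..T} t * cmod (of_real t * w t)))"
    using int_tent int_ind int_S int_tw R
    by (intro integral_mono Bochner_Integration.integrable_add integrable_mult_right integrable_norm
        Bochner_Integration.integrable_diff)
  also have "\<dots> = (LBINT t:?S. cmod (w t)) + 1 / T * (LBINT t:{-T..T}. cmod (of_real t * w t))"
    unfolding Bochner_Integration.integral_add[OF int_S integrable_mult_right[OF int_tw]]
    by (simp only: set_lebesgue_integral_def real_scaleR_def integral_mult_right_zero)
  finally show ?thesis by (simp only: mult.assoc add.assoc)
qed

text \<open>This determines the limit of \<open>D\<close> at the right end. Strict closeness weakens
  to \<open>\<le>\<close> in a right limit, hence the margin \<open>e / 2\<close>.\<close>

lemma tendsto_right_limits_at_top: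
  fixes g D :: "real \<Rightarrow> real"
  assumes g: "(g \<longlongrightarrow> l) at_top" and D: "\<And>x. (g \<longlongrightarrow> D x) (at_right x)"
  shows "(D \<longlongrightarrow> l) at_top"
proof (rule tendstoI)
  fix e :: real assume "e > 0"
  then have "\<forall>\<^sub>F z in at_top. dist (g z) l < e / 2" using tendstoD[OF g, of "e / 2"] by simp
  then obtain X where X: "\<And>z. X \<le> z \<Longrightarrow> dist (g z) l < e / 2" by (auto simp: eventually_at_top_linorder)
  show "\<forall>\<^sub>F x in at_top. dist (D x) l < e"
    using eventually_ge_at_top[of X]
  proof eventually_elim
    fix x assume "X \<le> x"
    then have ev: "\<forall>\<^sub>F z in at_right x. dist (g z) l \<le> e / 2"
      using eventually_at_right_less[of x] X by (auto elim!: eventually_mono intro: less_imp_le)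
    have "dist (D x) l \<le> e / 2"
      by (rule tendsto_upperbound[OF tendsto_dist[OF D tendsto_const] ev]) simp
    then show "dist (D x) l < e" using \<open>e > 0\<close> by simp
  qed
qed

section \<open>From Jordan measures and segment integrals to the bound on the supremum\<close>

theorem proposition4p1:
  fixes F H :: "real \<Rightarrow> real" and f h :: "real \<Rightarrow> complex"
    and f_ext h_ext :: "complex \<Rightarrow> complex"
    and m M r T b :: real
  assumes F_mono: "mono F"
    and H_diff: "H differentiable_on UNIV"
    and H_bv: "bounded_variation H"
    and H_deriv_bdd: "bdd_above (range (\<lambda>y. \<bar>deriv H y\<bar>))"
    and lim_neg: "(F \<longlongrightarrow> m) at_bot" "(H \<longlongrightarrow> m) at_bot"
    and lim_pos: "(F \<longlongrightarrow> M) at_top" "(H \<longlongrightarrow> M) at_top"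
    and f_def: "\<And>t. f t = fourier_stieltjes F t"
    and h_def: "\<And>t. h t = fourier_stieltjes H t"
    and r_pos: "r > 0"
    and f_ext: "f_ext analytic_on ball 0 r" "\<And>t. \<bar>t\<bar> < r \<Longrightarrow> f_ext (of_real t) = f t"
    and h_ext: "h_ext analytic_on ball 0 r" "\<And>t. \<bar>t\<bar> < r \<Longrightarrow> h_ext (of_real t) = h t"
    and T_ge: "T \<ge> r"
    and b_pos: "b > 0"
    and b_eq: "(LBINT y:{-b..b}. fejer_density y) = 3 / 4"
  shows "(SUP y. \<bar>F y - H y\<bar>) \<le>
      1 / pi * (SUP y\<in>{..0::real}. cmod (lower_semicircle_integral r
        (\<lambda>z. (f_ext z - h_ext z) / z * exp (\<i> * z * of_real y) * exp (- (\<i> * of_real b * (z / of_real T))))))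
    + 1 / pi * (SUP y\<in>{0::real<..}. cmod (upper_semicircle_integral r
        (\<lambda>z. (f_ext z - h_ext z) / z * exp (\<i> * z * of_real y) * exp (- (\<i> * of_real b * (z / of_real T))))))
    + 1 / pi * (SUP y\<in>{..0::real}. cmod (lower_semicircle_integral r
        (\<lambda>z. (f_ext z - h_ext z) / z * exp (\<i> * z * of_real y) * exp (\<i> * of_real b * (z / of_real T)))))
    + 1 / pi * (SUP y\<in>{0::real<..}. cmod (upper_semicircle_integral r
        (\<lambda>z. (f_ext z - h_ext z) / z * exp (\<i> * z * of_real y) * exp (\<i> * of_real b * (z / of_real T)))))
    + 1 / pi * (LBINT t:{t. r \<le> \<bar>t\<bar> \<and> \<bar>t\<bar> \<le> T}. cmod ((f t - h t) / of_real t))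
    + 2 / (pi * T) * (LBINT t:{-T..T}. cmod (f t - h t))
    + 3 * b / T * (SUP y. \<bar>deriv H y\<bar>)"
proof -
  have T0: "T > 0" using r_pos T_ge by simp
  have F_bound: "m \<le> F x" "F x \<le> M" for x
    by (rule tendsto_upperbound[OF lim_neg(1) eventually_mono[OF eventually_le_at_bot[of x]]])
       (auto intro: monoD[OF F_mono],
        rule tendsto_lowerbound[OF lim_pos(1) eventually_mono[OF eventually_ge_at_top[of x]]],
        auto intro: monoD[OF F_mono])
  have F_abs: "\<bar>F x\<bar> \<le> \<bar>m\<bar> + \<bar>M\<bar>" for x using F_bound[of x] by auto
  obtain C where C: "\<And>x. \<bar>H x\<bar> \<le> C" using bounded_variation_bounded[OF H_bv] by blast
  \<comment> \<open>A bounded nondecreasing function has bounded variation, so one decomposition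
    lemma represents both \<open>F\<close> and \<open>H\<close>.\<close>
  obtain P1 N1 where meas1: "finite_borel_measure P1" "finite_borel_measure N1"
    and f_eq: "\<And>t. fourier_stieltjes F t = fourier P1 t - fourier N1 t"
    and F_right: "\<And>x. (F \<longlongrightarrow> m + cdf P1 x - cdf N1 x) (at_right x)"
    using bounded_variation_measures[OF mono_bounded_variation[OF F_mono F_abs] lim_neg(1)] by metis
  obtain P2 N2 where meas2: "finite_borel_measure P2" "finite_borel_measure N2"
    and h_eq: "\<And>t. fourier_stieltjes H t = fourier P2 t - fourier N2 t"
    and H_right: "\<And>x. (H \<longlongrightarrow> m + cdf P2 x - cdf N2 x) (at_right x)"
    using bounded_variation_measures[OF H_bv lim_neg(2)] by metis
  note meas = meas1 meas2
  \<comment> \<open>The constant \<open>m\<close> cancels because \<open>F\<close> and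
    \<open>H\<close> share their limit at the left end.\<close>
  define D where "D x = (cdf P1 x - cdf N1 x) - (cdf P2 x - cdf N2 x)" for x
  have D: "((\<lambda>z. F z - H z) \<longlongrightarrow> D x) (at_right x)" for x
    using tendsto_diff[OF F_right[of x] H_right[of x]] by (simp add: D_def algebra_simps)
  have [measurable]: "D \<in> borel_measurable borel"
    unfolding D_def[abs_def] using meas by (intro borel_measurable_diff finite_borel_measure.cdf_measurable)
  have fh: "f t - h t = (fourier P1 t - fourier N1 t) - (fourier P2 t - fourier N2 t)" for t
    by (simp add: f_def h_def f_eq h_eq)
  have fh_cont: "isCont (\<lambda>t. f t - h t) t" for t
    unfolding fh using meas by (intro continuous_intros finite_borel_measure.isCont_fourier)

  \<comment> \<open>Equal limits at the right end balance the total masses, so \<open>f - h\<close>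
    vanishes at \<open>0\<close>. This removes the pole of the integrand at the origin.\<close>
  have "((\<lambda>x. F x - H x) \<longlongrightarrow> M - M) at_top" by (intro tendsto_intros lim_pos)
  then have "(D \<longlongrightarrow> M - M) at_top" using D by (rule tendsto_right_limits_at_top)
  moreover have "(D \<longlongrightarrow> (measure P1 UNIV - measure N1 UNIV) - (measure P2 UNIV - measure N2 UNIV)) at_top"
    unfolding D_def
    using meas[THEN finite_borel_measure.cdf_lim_at_top] meas[THEN finite_borel_measure.borel_UNIV]
    by (intro tendsto_intros) simp_all
  ultimately have "(measure P1 UNIV - measure N1 UNIV) - (measure P2 UNIV - measure N2 UNIV) = 0"
    using tendsto_unique[OF trivial_limit_at_top_linorder] by fastforce
  then have fh0: "f 0 - h 0 = 0"
    unfolding fh meas[THEN finite_borel_measure.fourier_0] by (simp flip: of_real_diff)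

  have ext_eq: "f_ext (of_real t) - h_ext (of_real t) = f t - h t" if "\<bar>t\<bar> < r" for t
    using f_ext(2)[OF that] h_ext(2)[OF that] by simp
  have "(\<lambda>z. f_ext z - h_ext z) holomorphic_on ball 0 r"
    using f_ext(1) h_ext(1) by (intro holomorphic_intros analytic_imp_holomorphic)
  moreover have "f_ext 0 - h_ext 0 = 0" using ext_eq[of 0] fh0 r_pos by simp
  ultimately obtain q where q: "q holomorphic_on ball 0 r"
    "\<And>z. z \<in> ball 0 r \<Longrightarrow> f_ext z - h_ext z = z * q z"
    using holomorphic_quotient_at_0[OF _ open_ball, of "\<lambda>z. f_ext z - h_ext z" 0 r] by metis
  \<comment> \<open>The gap of the real quotient at \<open>0\<close> is filled by the holomorphic
    quotient \<open>q\<close>. Continuity at \<open>0\<close> comes from \<open>q\<close>, elsewhere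
    from continuity of the Fourier transforms.\<close>
  define w where "w t = (if t = 0 then q 0 else (f t - h t) / of_real t)" for t
  have tw: "of_real t * w t = f t - h t" for t using fh0 by (simp add: w_def)
  have wq: "w t = q (of_real t)" if "\<bar>t\<bar> < r" for t
    using ext_eq[OF that] q(2)[of "of_real t"] that
    by (auto simp: w_def nonzero_divide_eq_eq mult.commute)
  have w: "continuous_on UNIV w"
  proof (intro continuous_at_imp_continuous_on ballI)
    fix t
    show "isCont w t"
    proof (cases "t = 0")
      case True
      have "isCont q (of_real t)"
        using r_pos True
        by (intro continuous_on_interior[OF holomorphic_on_imp_continuous_on[OF q(1)]]) simp
      then have "isCont (\<lambda>t. q (of_real t)) t"
        by (rule isCont_o2[rotated]) (intro continuous_intros)
      moreover have "\<forall>\<^sub>F s in nhds t. \<bar>s\<bar> < r"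
        using True r_pos by (intro eventually_nhds_in_open[of "{-r<..<r}", THEN eventually_mono]) auto
      then have "\<forall>\<^sub>F s in nhds t. w s = q (of_real s)" by eventually_elim (rule wq)
      ultimately show ?thesis by (simp add: isCont_cong)
    next
      case False
      have "isCont (\<lambda>t. (f t - h t) / of_real t) t"
        using False by (intro isCont_divide fh_cont) auto
      moreover have "\<forall>\<^sub>F s in nhds t. s \<noteq> 0" using False by (rule t1_space_nhds)
      then have "\<forall>\<^sub>F s in nhds t. w s = (f s - h s) / of_real s"
        by eventually_elim (simp add: w_def)
      ultimately show ?thesis by (simp add: isCont_cong)
    qed
  qed

  define I where "I x = integral {-r..r} (\<lambda>t. w t * exp (\<i> * of_real t * of_real x))" for x
  \<comment> \<open>The additional exponential only shifts \<open>y\<close> by \<open>v\<close>,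
    which will be \<open>- b / T\<close> or \<open>b / T\<close>; both semicircles then give the
    same segment integral.\<close>
  have arc: "boundary_arc_integral r pi c (\<lambda>z. (f_ext z - h_ext z) / z * exp (\<i> * z * of_real y) * E z) = I (y + v)"
    if "exp (\<i> * of_real c) = 1" "\<And>z. E z = exp (\<i> * z * of_real v)" for c y v E
    unfolding I_def
  proof (rule boundary_arc_integral_eq_segment[where G = "\<lambda>z. q z * exp (\<i> * z * of_real (y + v))"])
    show "(\<lambda>z. q z * exp (\<i> * z * of_real (y + v))) holomorphic_on ball 0 r"
      by (intro holomorphic_intros q)
    show "(f_ext z - h_ext z) / z * exp (\<i> * z * of_real y) * E z = q z * exp (\<i> * z * of_real (y + v))"
      if "z \<in> ball 0 r" "z \<noteq> 0" for z
      using that q(2)[OF that(1)] \<open>\<And>z. E z = _\<close> by (simp add: ring_distribs exp_add)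
    show "continuous_on {-r..r} (\<lambda>t. w t * exp (\<i> * of_real t * of_real (y + v)))"
      by (intro continuous_intros continuous_on_subset[OF w]) simp
  qed (use r_pos wq that in auto)
  have exp1: "exp (- (\<i> * of_real b * (z / of_real T))) = exp (\<i> * z * of_real (- b / T))" for z
    by (simp add: mult_ac)
  have exp2: "exp (\<i> * of_real b * (z / of_real T)) = exp (\<i> * z * of_real (b / T))" for z
    by (simp add: mult_ac)
  have c: "exp (\<i> * of_real (2 * pi)) = 1" "exp (\<i> * of_real 0) = 1"
    by (simp_all add: exp_eq_1)
  note arcs = arc[OF c(1) exp1] arc[OF c(2) exp1] arc[OF c(1) exp2] arc[OF c(2) exp2]

  \<comment> \<open>On the real segment the exponentials have norm \<open>1\<close>, so one bound
    serves all \<open>x\<close>. Boundedness is what makes the real suprema genuine upper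
    bounds.\<close>
  have "cmod (I x) \<le> integral {-r..r} (\<lambda>t. cmod (w t))" for x
    unfolding I_def
    by (rule integral_norm_bound_integral)
       (auto simp: norm_mult intro!: integrable_continuous_interval continuous_intros continuous_on_subset[OF w])
  then have bdd: "bdd_above ((\<lambda>y. cmod (I (y + v))) ` A)" for v A
    by (intro bdd_aboveI2)
  define S where "S v = (SUP y\<in>{..0::real}. cmod (I (y + v)))" for v
  define S' where "S' v = (SUP y\<in>{0::real<..}. cmod (I (y + v)))" for v
  have S0: "0 \<le> S v" for v
    unfolding S_def by (rule order_trans[OF norm_ge_zero cSUP_upper[OF _ bdd, of 0]]) simp
  have S'0: "0 \<le> S' v" for v
    unfolding S'_def by (rule order_trans[OF norm_ge_zero cSUP_upper[OF _ bdd, of 1]]) simp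
  \<comment> \<open>For a fixed shift \<open>v\<close>, the number \<open>x - v\<close> lies either
    in \<open>{..0}\<close> or in \<open>{0<..}\<close>, so one pair of suprema controls every
    \<open>x\<close>.\<close>
  have IS: "cmod (I x) \<le> S v + S' v" for x v
  proof (cases "x - v \<le> 0")
    case True
    then have "cmod (I (x - v + v)) \<le> S v" unfolding S_def by (intro cSUP_upper[OF _ bdd]) auto
    then show ?thesis using S'0[of v] by simp
  next
    case False
    then have "cmod (I (x - v + v)) \<le> S' v" unfolding S'_def by (intro cSUP_upper[OF _ bdd]) auto
    then show ?thesis using S0[of v] by simp
  qed

  define B1 where "B1 = (LBINT t:{t. r \<le> \<bar>t\<bar> \<and> \<bar>t\<bar> \<le> T}. cmod ((f t - h t) / of_real t))"
  define B2 where "B2 = (LBINT t:{-T..T}. cmod (f t - h t))"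
  have B1: "B1 = (LBINT t:{t. r \<le> \<bar>t\<bar> \<and> \<bar>t\<bar> \<le> T}. cmod (w t))"
    unfolding B1_def set_lebesgue_integral_def using r_pos
    by (intro Bochner_Integration.integral_cong) (auto simp: w_def split: split_indicator)
  have B2: "0 \<le> B2" unfolding B2_def set_lebesgue_integral_def by simp
  \<comment> \<open>The factor \<open>1 / (2 * pi)\<close> comes from inversion; the
    \<open>2 * K\<close> of the smoothing inequality turns it into \<open>1 / pi\<close>.\<close>
  define K where "K = 1 / (2 * pi) * (S (b / T) + S' (b / T) + B1 + 1 / T * B2)"
  have K: "\<bar>LBINT u. D (x - u) * (T * fejer_density (T * u))\<bar> \<le> K" for x
  proof -
    have "complex_of_real (LBINT u. D (x - u) * (T * fejer_density (T * u)))
      = (LBINT t. of_real (tent T t) * w t * exp (\<i> * of_real t * of_real x)) / (2 * pi * \<i>)"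
      unfolding D_def by (rule fejer_smoothing_identity[OF T0 meas w]) (simp add: tw fh)
    then have "\<bar>LBINT u. D (x - u) * (T * fejer_density (T * u))\<bar>
      = 1 / (2 * pi) * cmod (LBINT t. of_real (tent T t) * w t * exp (\<i> * of_real t * of_real x))"
      by (subst norm_of_real[where 'a = complex, symmetric]) (simp add: norm_divide norm_mult)
    also have "\<dots> \<le> K"
      unfolding K_def
      using tent_integral_bound[OF r_pos T_ge w, of x] IS[of x "b / T"]
      by (intro mult_left_mono) (auto simp: I_def B1 B2_def tw)
    finally show ?thesis .
  qed

  define L where "L = (SUP y. \<bar>deriv H y\<bar>)"
  have H_lip: "\<bar>H x - H y\<bar> \<le> L * \<bar>x - y\<bar>" for x y
  proof -
    have "norm (H x - H y) \<le> L * norm (x - y)"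
    proof (rule field_differentiable_bound)
      fix z :: real
      show "(H has_field_derivative deriv H z) (at z within UNIV)"
        using H_diff by (simp add: differentiable_on_def DERIV_deriv_iff_real_differentiable)
      show "norm (deriv H z) \<le> L"
        unfolding L_def real_norm_def by (rule cSUP_upper[OF UNIV_I H_deriv_bdd])
    qed auto
    then show ?thesis by simp
  qed
  have FH: "\<bar>F y - H y\<bar> \<le> \<bar>m\<bar> + \<bar>M\<bar> + C" for y
    using F_abs[of y] C[of y] by linarith
  have "(SUP y. \<bar>F y - H y\<bar>) \<le> 2 * K + 3 * b / T * L"
  proof (rule fejer_smoothing_inequality[OF F_mono H_lip _ D _ _ T0 b_pos b_eq K])
    show "\<bar>F y - H y\<bar> \<le> (SUP y. \<bar>F y - H y\<bar>)" for y
      by (rule cSUP_upper) (auto intro!: bdd_aboveI2 FH)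
    show "(SUP y. \<bar>F y - H y\<bar>) \<le> \<epsilon>" if "\<And>y. \<bar>F y - H y\<bar> \<le> \<epsilon>" for \<epsilon>
      using that by (intro cSUP_least) auto
  qed measurable
  also have "2 * K = 1 / pi * S (b / T) + 1 / pi * S' (b / T) + 1 / pi * B1 + 1 / (pi * T) * B2"
    using T0 by (simp add: K_def field_simps)
  \<comment> \<open>The suprema for the shift \<open>- b / T\<close> are nonnegative and may be
    added, as may a second copy of \<open>1 / (pi * T) * B2\<close>.\<close>
  also have "\<dots> \<le> 1 / pi * S (- b / T) + 1 / pi * S' (- b / T) + 1 / pi * S (b / T) + 1 / pi * S' (b / T)
      + 1 / pi * B1 + 2 / (pi * T) * B2"
  proof -
    have "0 \<le> 1 / pi * S (- b / T)" "0 \<le> 1 / pi * S' (- b / T)" using S0 S'0 by simp_all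
    moreover have "1 / (pi * T) * B2 \<le> 2 / (pi * T) * B2"
      using T0 B2 by (intro mult_right_mono divide_right_mono) auto
    ultimately show ?thesis by linarith
  qed
  finally show ?thesis
    unfolding lower_semicircle_integral_def upper_semicircle_integral_def arcs S_def S'_def B1_def B2_def L_def
    by simp
qed

end
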